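(* Let $(\mathsf{T},\mathsf{U},Q)$ be a duality triple. Then a morphism $f\colon X\to Y$ in $\mathsf{T}$ is phantom if and only if $Q(f)=0$. In particular, a triangle $A\to B\to C\to\Sigma A$ in $\mathsf{T}$ is pure if and only if the induced triangle $Q(C)\to Q(B)\to Q(A)\to \Sigma Q(C)$ in $\mathsf{U}$ splits.
   Context: Let $\mathsf{T}$ be a triangulated category with set-indexed coproducts and shift $\Sigma$. An object $C$ is compact if $\mathrm{Hom}_{\mathsf{T}}(C,-)$ preserves coproducts; $\mathsf{T}^{\mathrm{c}}$ is the full subcategory of compact objects. $\mathsf{T}$ is compactly generated if there is a set $\mathscr{G}$ of compact objects such that $X\simeq 0$ if and only if $\mathrm{Hom}_{\mathsf{T}}(\Sigma^iG,X)=0$ for all $G\in\mathscr{G}$, $i\in\mathbb{Z}$. $\mathrm{Mod}(\mathsf{T}^{\mathrm{c}})$ is the category of additive functors $(\mathsf{T}^{\mathrm{c}})^{\mathrm{op}}\to\mathbf{Ab}$, and $\mathbf{y}\colon\mathsf{T}\to\mathrm{Mod}(\mathsf{T}^{\mathrm{c}})$, $\mathbf{y}X=\mathrm{Hom}_{\mathsf{T}}(-,X)|_{\mathsf{T}^{\mathrm{c}}}$. A triangle $X\xrightarrow{\alpha} Y\xrightarrow{\beta} Z\to\Sigma X$ is pure if $0\to\mathbf{y}X\to\mathbf{y}Y\to\mathbf{y}Z\to0$ is exact; then $\alpha$ is called a pure monomorphism. A morphism $f$ is phantom if $\mathrm{Hom}_{\mathsf{T}}(C,f)=0$ for all $C\in\mathsf{T}^{\mathrm{c}}$.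 An object $X$ is pure injective if $\mathbf{y}X$ is injective in $\mathrm{Mod}(\mathsf{T}^{\mathrm{c}})$ (equivalently every pure monomorphism $X\to Y$ splits). A duality triple $(\mathsf{T},\mathsf{U},Q)$ consists of two compactly generated triangulated categories $\mathsf{T},\mathsf{U}$ and exact functors $Q\colon\mathsf{T}^{\mathrm{op}}\to\mathsf{U}$ and $Q\colon\mathsf{U}^{\mathrm{op}}\to\mathsf{T}$ (both denoted $Q$) such that: (1) $Q(X)$ is pure injective for every $X$ in $\mathsf{T}$ or $\mathsf{U}$; (2) for every $X$ in $\mathsf{T}$ or $\mathsf{U}$ there is a natural map $i_X\colon X\to Q^2(X)$ which is a pure monomorphism; (3) $Q(i_X)\circ i_{Q(X)}$ is the identity for every $X$ in $\mathsf{T}$ or $\mathsf{U}$; (4) $Q(\bigoplus_I X_i)\simeq\prod_I Q(X_i)$ for every set of objects $\{X_i\}_I$ in $\mathsf{T}$ or in $\mathsf{U}$. *)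

theory Defs
  imports "HOL-Algebra.Free_Abelian_Groups"
begin

section \<open>Sets and classes\<close>

text \<open>
  Categories with set-indexed coproducts require a distinction between sets and classes. The
  sets are the collections of cardinality strictly below that of a type \<open>'v\<close>, whose cardinality
  is assumed to be strongly inaccessible, so that \<open>'v\<close> plays the role of a Grothendieck
  universe. Classes of objects range over arbitrary types.
\<close>

definition inaccessible :: "'v itself \<Rightarrow> bool" where
  "inaccessible V \<longleftrightarrow>
     (UNIV :: nat set) \<prec> (UNIV :: 'v set) \<and>
     (\<forall>A :: 'v set. A \<prec> (UNIV :: 'v set) \<longrightarrow> Pow A \<prec> (UNIV :: 'v set)) \<and>
     (\<forall>(I :: 'v set) (B :: 'v \<Rightarrow> 'v set).
        I \<prec> (UNIV :: 'v set) \<and> (\<forall>i\<in>I. B i \<prec> (UNIV :: 'v set)) \<longrightarrow>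
        (\<Union>i\<in>I. B i) \<prec> (UNIV :: 'v set))"

definition small :: "'v itself \<Rightarrow> 'a set \<Rightarrow> bool" where
  "small V A \<longleftrightarrow> A \<prec> (UNIV :: 'v set)"


section \<open>Additive categories\<close>

text \<open>
  Hom-sets are commutative groups in the (multiplicative) notation of \<open>monoid\<close>: the sum of
  morphisms is \<open>\<otimes>\<close>, the zero morphism is \<open>\<one>\<close> and the negative is \<open>inv\<close>.
\<close>

record ('o, 'm) cat =
  obj :: "'o set"
  Hom :: "'o \<Rightarrow> 'o \<Rightarrow> 'm monoid"
  idm :: "'o \<Rightarrow> 'm"
  cmp :: "'m \<Rightarrow> 'm \<Rightarrow> 'm" (infixl "\<cdot>\<index>" 70)

abbreviation mor :: "('o, 'm, 'x) cat_scheme \<Rightarrow> 'o \<Rightarrow> 'o \<Rightarrow> 'm set" where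
  "mor C X Y \<equiv> carrier (Hom C X Y)"

abbreviation zero_mor :: "('o, 'm, 'x) cat_scheme \<Rightarrow> 'o \<Rightarrow> 'o \<Rightarrow> 'm" where
  "zero_mor C X Y \<equiv> \<one>\<^bsub>Hom C X Y\<^esub>"

locale preadditive_category =
  fixes C :: "('o, 'm, 'x) cat_scheme" (structure)
  assumes Hom_comm_group: "\<lbrakk>X \<in> obj C; Y \<in> obj C\<rbrakk> \<Longrightarrow> comm_group (Hom C X Y)"
    and Hom_disjoint: "\<lbrakk>X \<in> obj C; Y \<in> obj C; X' \<in> obj C; Y' \<in> obj C;
        f \<in> mor C X Y; f \<in> mor C X' Y'\<rbrakk> \<Longrightarrow> X = X' \<and> Y = Y'"
    and idm_closed: "X \<in> obj C \<Longrightarrow> idm C X \<in> mor C X X"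
    and cmp_closed: "\<lbrakk>X \<in> obj C; Y \<in> obj C; Z \<in> obj C; f \<in> mor C X Y; g \<in> mor C Y Z\<rbrakk>
        \<Longrightarrow> g \<cdot> f \<in> mor C X Z"
    and cmp_assoc: "\<lbrakk>W \<in> obj C; X \<in> obj C; Y \<in> obj C; Z \<in> obj C;
        f \<in> mor C W X; g \<in> mor C X Y; h \<in> mor C Y Z\<rbrakk> \<Longrightarrow> (h \<cdot> g) \<cdot> f = h \<cdot> (g \<cdot> f)"
    and cmp_idm_right: "\<lbrakk>X \<in> obj C; Y \<in> obj C; f \<in> mor C X Y\<rbrakk> \<Longrightarrow> f \<cdot> idm C X = f"
    and cmp_idm_left: "\<lbrakk>X \<in> obj C; Y \<in> obj C; f \<in> mor C X Y\<rbrakk> \<Longrightarrow> idm C Y \<cdot> f = f"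
    and cmp_add_left: "\<lbrakk>X \<in> obj C; Y \<in> obj C; Z \<in> obj C;
        f \<in> mor C X Y; g \<in> mor C Y Z; g' \<in> mor C Y Z\<rbrakk>
        \<Longrightarrow> (g \<otimes>\<^bsub>Hom C Y Z\<^esub> g') \<cdot> f = (g \<cdot> f) \<otimes>\<^bsub>Hom C X Z\<^esub> (g' \<cdot> f)"
    and cmp_add_right: "\<lbrakk>X \<in> obj C; Y \<in> obj C; Z \<in> obj C;
        f \<in> mor C X Y; f' \<in> mor C X Y; g \<in> mor C Y Z\<rbrakk>
        \<Longrightarrow> g \<cdot> (f \<otimes>\<^bsub>Hom C X Y\<^esub> f') = (g \<cdot> f) \<otimes>\<^bsub>Hom C X Z\<^esub> (g \<cdot> f')"

definition zero_object :: "('o, 'm, 'x) cat_scheme \<Rightarrow> 'o \<Rightarrow> bool" where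
  "zero_object C Z \<longleftrightarrow> Z \<in> obj C \<and>
     (\<forall>X\<in>obj C. (\<exists>!f. f \<in> mor C X Z) \<and> (\<exists>!f. f \<in> mor C Z X))"

definition biproduct ::
  "('o, 'm, 'x) cat_scheme \<Rightarrow> 'o \<Rightarrow> 'o \<Rightarrow> 'o \<Rightarrow> 'm \<Rightarrow> 'm \<Rightarrow> 'm \<Rightarrow> 'm \<Rightarrow> bool" where
  "biproduct C X Y S i j p q \<longleftrightarrow>
     X \<in> obj C \<and> Y \<in> obj C \<and> S \<in> obj C \<and>
     i \<in> mor C X S \<and> j \<in> mor C Y S \<and> p \<in> mor C S X \<and> q \<in> mor C S Y \<and>
     p \<cdot>\<^bsub>C\<^esub> i = idm C X \<and> q \<cdot>\<^bsub>C\<^esub> j = idm C Y \<and>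
     q \<cdot>\<^bsub>C\<^esub> i = zero_mor C X Y \<and> p \<cdot>\<^bsub>C\<^esub> j = zero_mor C Y X \<and>
     (i \<cdot>\<^bsub>C\<^esub> p) \<otimes>\<^bsub>Hom C S S\<^esub> (j \<cdot>\<^bsub>C\<^esub> q) = idm C S"

locale additive_category = preadditive_category +
  assumes ex_zero_object: "\<exists>Z. zero_object C Z"
    and ex_biproduct: "\<lbrakk>X \<in> obj C; Y \<in> obj C\<rbrakk> \<Longrightarrow> \<exists>S i j p q. biproduct C X Y S i j p q"

definition iso_mor :: "('o, 'm, 'x) cat_scheme \<Rightarrow> 'o \<Rightarrow> 'o \<Rightarrow> 'm \<Rightarrow> bool" where
  "iso_mor C X Y f \<longleftrightarrow> f \<in> mor C X Y \<and>
     (\<exists>g\<in>mor C Y X. g \<cdot>\<^bsub>C\<^esub> f = idm C X \<and> f \<cdot>\<^bsub>C\<^esub> g = idm C Y)"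

definition isomorphic :: "('o, 'm, 'x) cat_scheme \<Rightarrow> 'o \<Rightarrow> 'o \<Rightarrow> bool" where
  "isomorphic C X Y \<longleftrightarrow> X \<in> obj C \<and> Y \<in> obj C \<and> (\<exists>f. iso_mor C X Y f)"

definition is_coproduct ::
  "('o, 'm, 'x) cat_scheme \<Rightarrow> 'i set \<Rightarrow> ('i \<Rightarrow> 'o) \<Rightarrow> 'o \<Rightarrow> ('i \<Rightarrow> 'm) \<Rightarrow> bool" where
  "is_coproduct C I X S \<iota> \<longleftrightarrow>
     S \<in> obj C \<and> (\<forall>i\<in>I. X i \<in> obj C \<and> \<iota> i \<in> mor C (X i) S) \<and>
     (\<forall>Z\<in>obj C. \<forall>f. (\<forall>i\<in>I. f i \<in> mor C (X i) Z) \<longrightarrow>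
        (\<exists>!g. g \<in> mor C S Z \<and> (\<forall>i\<in>I. g \<cdot>\<^bsub>C\<^esub> \<iota> i = f i)))"

definition is_product ::
  "('o, 'm, 'x) cat_scheme \<Rightarrow> 'i set \<Rightarrow> ('i \<Rightarrow> 'o) \<Rightarrow> 'o \<Rightarrow> ('i \<Rightarrow> 'm) \<Rightarrow> bool" where
  "is_product C I X P \<pi> \<longleftrightarrow>
     P \<in> obj C \<and> (\<forall>i\<in>I. X i \<in> obj C \<and> \<pi> i \<in> mor C P (X i)) \<and>
     (\<forall>Z\<in>obj C. \<forall>f. (\<forall>i\<in>I. f i \<in> mor C Z (X i)) \<longrightarrow>
        (\<exists>!g. g \<in> mor C Z P \<and> (\<forall>i\<in>I. \<pi> i \<cdot>\<^bsub>C\<^esub> g = f i)))"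

text \<open>Every small set is in bijection with a small subset of \<open>'v\<close>, so these suffice as index sets.\<close>

definition has_small_coproducts :: "'v itself \<Rightarrow> ('o, 'm, 'x) cat_scheme \<Rightarrow> bool" where
  "has_small_coproducts V C \<longleftrightarrow>
     (\<forall>(I :: 'v set) X. small V I \<and> (\<forall>i\<in>I. X i \<in> obj C) \<longrightarrow> (\<exists>S \<iota>. is_coproduct C I X S \<iota>))"

text \<open>
  For a coproduct \<open>S\<close> of a family \<open>X\<close>, the canonical map from the direct sum of the groups
  \<open>Hom C D (X i)\<close> to \<open>Hom C D S\<close> has to be an isomorphism. Here \<open>gfinprod\<close> is the finitely
  supported sum in \<open>Hom C D S\<close>.
\<close>

definition compact_object :: "'v itself \<Rightarrow> ('o, 'm, 'x) cat_scheme \<Rightarrow> 'o \<Rightarrow> bool" where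
  "compact_object V C D \<longleftrightarrow> D \<in> obj C \<and>
     (\<forall>(I :: 'v set) X S \<iota>. small V I \<and> is_coproduct C I X S \<iota> \<longrightarrow>
        (\<lambda>x. gfinprod (Hom C D S) (\<lambda>i. \<iota> i \<cdot>\<^bsub>C\<^esub> x i) I)
          \<in> iso (sum_group I (\<lambda>i. Hom C D (X i))) (Hom C D S))"

definition compacts :: "'v itself \<Rightarrow> ('o, 'm, 'x) cat_scheme \<Rightarrow> ('o, 'm, 'x) cat_scheme" where
  "compacts V C = C\<lparr>obj := {D. compact_object V C D}\<rparr>"


section \<open>Triangulated categories\<close>

record ('o, 'm) tricat = "('o, 'm) cat" +
  Sh :: "'o \<Rightarrow> 'o"
  sh :: "'m \<Rightarrow> 'm"
  triangle :: "'o \<Rightarrow> 'o \<Rightarrow> 'o \<Rightarrow> 'm \<Rightarrow> 'm \<Rightarrow> 'm \<Rightarrow> bool"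

definition candidate_triangle ::
  "('o, 'm, 'x) tricat_scheme \<Rightarrow> 'o \<Rightarrow> 'o \<Rightarrow> 'o \<Rightarrow> 'm \<Rightarrow> 'm \<Rightarrow> 'm \<Rightarrow> bool" where
  "candidate_triangle T X Y Z f g h \<longleftrightarrow> X \<in> obj T \<and> Y \<in> obj T \<and> Z \<in> obj T \<and>
     f \<in> mor T X Y \<and> g \<in> mor T Y Z \<and> h \<in> mor T Z (Sh T X)"

text \<open>The shift is only required to be an autoequivalence, not an automorphism.\<close>

locale triangulated_category = additive_category T
  for T :: "('o, 'm, 'x) tricat_scheme" (structure) +
  assumes Sh_closed: "X \<in> obj T \<Longrightarrow> Sh T X \<in> obj T"
    and sh_idm: "X \<in> obj T \<Longrightarrow> sh T (idm T X) = idm T (Sh T X)"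
    and sh_cmp: "\<lbrakk>X \<in> obj T; Y \<in> obj T; Z \<in> obj T; f \<in> mor T X Y; g \<in> mor T Y Z\<rbrakk>
        \<Longrightarrow> sh T (g \<cdot> f) = sh T g \<cdot> sh T f"
    and sh_iso: "\<lbrakk>X \<in> obj T; Y \<in> obj T\<rbrakk> \<Longrightarrow> sh T \<in> iso (Hom T X Y) (Hom T (Sh T X) (Sh T Y))"
    and Sh_ess_surj: "Y \<in> obj T \<Longrightarrow> \<exists>X\<in>obj T. isomorphic T (Sh T X) Y"
    and triangle_candidate: "triangle T X Y Z f g h \<Longrightarrow> candidate_triangle T X Y Z f g h"
    and triangle_iso: "\<lbrakk>triangle T X Y Z f g h; candidate_triangle T X' Y' Z' f' g' h';
        iso_mor T X X' a; iso_mor T Y Y' b; iso_mor T Z Z' c;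
        b \<cdot> f = f' \<cdot> a; c \<cdot> g = g' \<cdot> b; sh T a \<cdot> h = h' \<cdot> c\<rbrakk>
        \<Longrightarrow> triangle T X' Y' Z' f' g' h'"
    and triangle_idm: "\<lbrakk>X \<in> obj T; zero_object T Z\<rbrakk>
        \<Longrightarrow> triangle T X X Z (idm T X) (zero_mor T X Z) (zero_mor T Z (Sh T X))"
    and ex_triangle: "\<lbrakk>X \<in> obj T; Y \<in> obj T; f \<in> mor T X Y\<rbrakk> \<Longrightarrow> \<exists>Z g h. triangle T X Y Z f g h"
    and triangle_rotate: "candidate_triangle T X Y Z f g h \<Longrightarrow>
        triangle T X Y Z f g h \<longleftrightarrow>
        triangle T Y Z (Sh T X) g h (inv\<^bsub>Hom T (Sh T X) (Sh T Y)\<^esub> (sh T f))"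
    and triangle_mor: "\<lbrakk>triangle T X Y Z f g h; triangle T X' Y' Z' f' g' h';
        a \<in> mor T X X'; b \<in> mor T Y Y'; b \<cdot> f = f' \<cdot> a\<rbrakk>
        \<Longrightarrow> \<exists>c\<in>mor T Z Z'. c \<cdot> g = g' \<cdot> b \<and> sh T a \<cdot> h = h' \<cdot> c"
    and octahedral: "\<lbrakk>triangle T X Y U f f\<^sub>1 f\<^sub>2; triangle T Y Z W g g\<^sub>1 g\<^sub>2;
        triangle T X Z N (g \<cdot> f) k\<^sub>1 k\<^sub>2\<rbrakk>
        \<Longrightarrow> \<exists>u v. triangle T U N W u v (sh T f\<^sub>1 \<cdot> g\<^sub>2) \<and>
              u \<cdot> f\<^sub>1 = k\<^sub>1 \<cdot> g \<and> k\<^sub>2 \<cdot> u = f\<^sub>2 \<and> v \<cdot> k\<^sub>1 = g\<^sub>1 \<and> g\<^sub>2 \<cdot> v = sh T f \<cdot> k\<^sub>2"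

text \<open>
  The value of the \<open>i\<close>-th power of the shift at an object. For negative \<open>i\<close> it is determined up to
  isomorphism only, as is a quasi-inverse of the shift.
\<close>

definition shift_power :: "('o, 'm, 'x) tricat_scheme \<Rightarrow> int \<Rightarrow> 'o \<Rightarrow> 'o" where
  "shift_power T i X =
     (if 0 \<le> i then (Sh T ^^ nat i) X
      else (SOME Y. Y \<in> obj T \<and> isomorphic T ((Sh T ^^ nat (- i)) Y) X))"

definition compactly_generated :: "'v itself \<Rightarrow> ('o, 'm, 'x) tricat_scheme \<Rightarrow> bool" where
  "compactly_generated V T \<longleftrightarrow>
     triangulated_category T \<and>
     (\<forall>X\<in>obj T. \<forall>Y\<in>obj T. small V (mor T X Y)) \<and>
     has_small_coproducts V T \<and>
     (\<exists>\<G>. small V \<G> \<and> (\<forall>G\<in>\<G>. compact_object V T G) \<and>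
        (\<forall>X\<in>obj T. zero_object T X \<longleftrightarrow>
           (\<forall>G\<in>\<G>. \<forall>i. mor T (shift_power T i G) X = {zero_mor T (shift_power T i G) X})))"

text \<open>A triangle splits if it is isomorphic to \<open>X \<rightarrow> X \<oplus> Z \<rightarrow> Z \<rightarrow> Sh X\<close> with vanishing last map.\<close>

definition split_triangle ::
  "('o, 'm, 'x) tricat_scheme \<Rightarrow> 'o \<Rightarrow> 'o \<Rightarrow> 'o \<Rightarrow> 'm \<Rightarrow> 'm \<Rightarrow> 'm \<Rightarrow> bool" where
  "split_triangle T X Y Z f g h \<longleftrightarrow>
     triangle T X Y Z f g h \<and> h = zero_mor T Z (Sh T X) \<and> (\<exists>r s. biproduct T X Z Y f s r g)"


section \<open>Modules and purity\<close>

text \<open>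
  Additive functors from the opposite of \<open>C\<close> to abelian groups. Kernels, images and hence
  monomorphisms and exactness are computed objectwise. Since every small group is isomorphic to
  one with carrier in \<open>'v\<close>, modules with values in \<open>'v\<close> represent all of them; the
  representable modules have values in the type of morphisms, whence the mixed types.
\<close>

record ('o, 'm, 'g) presheaf =
  sec :: "'o \<Rightarrow> 'g monoid"
  res :: "'m \<Rightarrow> 'g \<Rightarrow> 'g"

definition is_module ::
  "'v itself \<Rightarrow> ('o, 'm, 'x) cat_scheme \<Rightarrow> ('o, 'm, 'g) presheaf \<Rightarrow> bool" where
  "is_module V C M \<longleftrightarrow>
     (\<forall>X\<in>obj C. comm_group (sec M X) \<and> small V (carrier (sec M X))) \<and>
     (\<forall>X\<in>obj C. \<forall>Y\<in>obj C. \<forall>f\<in>mor C X Y. res M f \<in> hom (sec M Y) (sec M X)) \<and>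
     (\<forall>X\<in>obj C. \<forall>x\<in>carrier (sec M X). res M (idm C X) x = x) \<and>
     (\<forall>X\<in>obj C. \<forall>Y\<in>obj C. \<forall>Z\<in>obj C. \<forall>f\<in>mor C X Y. \<forall>g\<in>mor C Y Z. \<forall>x\<in>carrier (sec M Z).
        res M (g \<cdot>\<^bsub>C\<^esub> f) x = res M f (res M g x)) \<and>
     (\<forall>X\<in>obj C. \<forall>Y\<in>obj C. \<forall>f\<in>mor C X Y. \<forall>g\<in>mor C X Y. \<forall>x\<in>carrier (sec M Y).
        res M (f \<otimes>\<^bsub>Hom C X Y\<^esub> g) x = res M f x \<otimes>\<^bsub>sec M X\<^esub> res M g x)"

definition module_hom :: "('o, 'm, 'x) cat_scheme \<Rightarrow> ('o, 'm, 'g) presheaf \<Rightarrow>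
    ('o, 'm, 'h) presheaf \<Rightarrow> ('o \<Rightarrow> 'g \<Rightarrow> 'h) \<Rightarrow> bool" where
  "module_hom C M N \<phi> \<longleftrightarrow>
     (\<forall>X\<in>obj C. \<phi> X \<in> hom (sec M X) (sec N X)) \<and>
     (\<forall>X\<in>obj C. \<forall>Y\<in>obj C. \<forall>f\<in>mor C X Y. \<forall>y\<in>carrier (sec M Y).
        \<phi> X (res M f y) = res N f (\<phi> Y y))"

definition module_mono :: "('o, 'm, 'x) cat_scheme \<Rightarrow> ('o, 'm, 'g) presheaf \<Rightarrow>
    ('o, 'm, 'h) presheaf \<Rightarrow> ('o \<Rightarrow> 'g \<Rightarrow> 'h) \<Rightarrow> bool" where
  "module_mono C M N \<phi> \<longleftrightarrow> module_hom C M N \<phi> \<and> (\<forall>X\<in>obj C. inj_on (\<phi> X) (carrier (sec M X)))"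

definition short_exact :: "('o, 'm, 'x) cat_scheme \<Rightarrow> ('o, 'm, 'g) presheaf \<Rightarrow>
    ('o, 'm, 'h) presheaf \<Rightarrow> ('o, 'm, 'k) presheaf \<Rightarrow>
    ('o \<Rightarrow> 'g \<Rightarrow> 'h) \<Rightarrow> ('o \<Rightarrow> 'h \<Rightarrow> 'k) \<Rightarrow> bool" where
  "short_exact C L M N \<phi> \<psi> \<longleftrightarrow> module_hom C L M \<phi> \<and> module_hom C M N \<psi> \<and>
     (\<forall>X\<in>obj C. inj_on (\<phi> X) (carrier (sec L X)) \<and>
        \<phi> X ` carrier (sec L X) = kernel (sec M X) (sec N X) (\<psi> X) \<and>
        \<psi> X ` carrier (sec M X) = carrier (sec N X))"

definition injective_module ::
  "'v itself \<Rightarrow> ('o, 'm, 'x) cat_scheme \<Rightarrow> ('o, 'm, 'g) presheaf \<Rightarrow> bool" where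
  "injective_module V C E \<longleftrightarrow> is_module V C E \<and>
     (\<forall>(M :: ('o, 'm, 'v) presheaf) (N :: ('o, 'm, 'v) presheaf) \<phi> \<psi>.
        is_module V C M \<and> is_module V C N \<and> module_mono C M N \<phi> \<and> module_hom C M E \<psi> \<longrightarrow>
        (\<exists>\<theta>. module_hom C N E \<theta> \<and>
             (\<forall>X\<in>obj C. \<forall>x\<in>carrier (sec M X). \<theta> X (\<phi> X x) = \<psi> X x)))"

definition yon :: "('o, 'm, 'x) cat_scheme \<Rightarrow> 'o \<Rightarrow> ('o, 'm, 'm) presheaf" where
  "yon T X = \<lparr>sec = (\<lambda>D. Hom T D X), res = (\<lambda>f g. g \<cdot>\<^bsub>T\<^esub> f)\<rparr>"

definition yon_mor :: "('o, 'm, 'x) cat_scheme \<Rightarrow> 'm \<Rightarrow> 'o \<Rightarrow> 'm \<Rightarrow> 'm" where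
  "yon_mor T f = (\<lambda>D g. f \<cdot>\<^bsub>T\<^esub> g)"

definition pure_triangle ::
  "'v itself \<Rightarrow> ('o, 'm, 'x) tricat_scheme \<Rightarrow> 'o \<Rightarrow> 'o \<Rightarrow> 'o \<Rightarrow> 'm \<Rightarrow> 'm \<Rightarrow> 'm \<Rightarrow> bool" where
  "pure_triangle V T X Y Z f g h \<longleftrightarrow> triangle T X Y Z f g h \<and>
     short_exact (compacts V T) (yon T X) (yon T Y) (yon T Z) (yon_mor T f) (yon_mor T g)"

definition pure_mono :: "'v itself \<Rightarrow> ('o, 'm, 'x) tricat_scheme \<Rightarrow> 'o \<Rightarrow> 'o \<Rightarrow> 'm \<Rightarrow> bool" where
  "pure_mono V T X Y f \<longleftrightarrow> (\<exists>Z g h. pure_triangle V T X Y Z f g h)"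

definition phantom :: "'v itself \<Rightarrow> ('o, 'm, 'x) cat_scheme \<Rightarrow> 'o \<Rightarrow> 'o \<Rightarrow> 'm \<Rightarrow> bool" where
  "phantom V T X Y f \<longleftrightarrow> f \<in> mor T X Y \<and>
     (\<forall>D. compact_object V T D \<longrightarrow> (\<forall>g\<in>mor T D X. f \<cdot>\<^bsub>T\<^esub> g = zero_mor T D Y))"

definition pure_injective :: "'v itself \<Rightarrow> ('o, 'm, 'x) cat_scheme \<Rightarrow> 'o \<Rightarrow> bool" where
  "pure_injective V T X \<longleftrightarrow> X \<in> obj T \<and> injective_module V (compacts V T) (yon T X)"


section \<open>Duality triples\<close>

text \<open>
  An exact functor \<open>F\<close> from the opposite of \<open>T\<close> to \<open>U\<close>. The shift of the opposite category is
  inverse to that of \<open>T\<close>, so compatibility with shifts is a natural isomorphism from \<open>F X\<close> to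
  \<open>Sh (F (Sh X))\<close>, denoted by \<open>Fs F X\<close>. Sign conventions for the triangles of the opposite
  category are absorbed by replacing \<open>Fs F\<close> with its negative.
\<close>

record ('o, 'm, 'p, 'n) contra_functor =
  Fo :: "'o \<Rightarrow> 'p"
  Fm :: "'m \<Rightarrow> 'n"
  Fs :: "'o \<Rightarrow> 'n"

definition induced_connecting :: "('p, 'n, 'y) tricat_scheme \<Rightarrow>
    ('o, 'm, 'p, 'n) contra_functor \<Rightarrow> 'o \<Rightarrow> 'm \<Rightarrow> 'n" where
  "induced_connecting U F X h = sh U (Fm F h) \<cdot>\<^bsub>U\<^esub> Fs F X"

locale exact_contra_functor =
  fixes T :: "('o, 'm, 'x) tricat_scheme" and U :: "('p, 'n, 'y) tricat_scheme"
    and F :: "('o, 'm, 'p, 'n) contra_functor"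
  assumes Fo_closed: "X \<in> obj T \<Longrightarrow> Fo F X \<in> obj U"
    and Fm_hom: "\<lbrakk>X \<in> obj T; Y \<in> obj T\<rbrakk> \<Longrightarrow> Fm F \<in> hom (Hom T X Y) (Hom U (Fo F Y) (Fo F X))"
    and Fm_idm: "X \<in> obj T \<Longrightarrow> Fm F (idm T X) = idm U (Fo F X)"
    and Fm_cmp: "\<lbrakk>X \<in> obj T; Y \<in> obj T; Z \<in> obj T; f \<in> mor T X Y; g \<in> mor T Y Z\<rbrakk>
        \<Longrightarrow> Fm F (g \<cdot>\<^bsub>T\<^esub> f) = Fm F f \<cdot>\<^bsub>U\<^esub> Fm F g"
    and Fs_iso: "X \<in> obj T \<Longrightarrow> iso_mor U (Fo F X) (Sh U (Fo F (Sh T X))) (Fs F X)"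
    and Fs_natural: "\<lbrakk>X \<in> obj T; Y \<in> obj T; f \<in> mor T X Y\<rbrakk>
        \<Longrightarrow> Fs F X \<cdot>\<^bsub>U\<^esub> Fm F f = sh U (Fm F (sh T f)) \<cdot>\<^bsub>U\<^esub> Fs F Y"
    and F_triangle: "triangle T X Y Z f g h
        \<Longrightarrow> triangle U (Fo F Z) (Fo F Y) (Fo F X) (Fm F g) (Fm F f) (induced_connecting U F X h)"

text \<open>
  \<open>P\<close> and \<open>R\<close> are the two functors of the triple; the predicate collects the conditions on
  objects of \<open>T\<close>, given natural maps \<open>i\<close> on \<open>T\<close> and \<open>j\<close> on \<open>U\<close>.
\<close>

definition half_duality :: "'v itself \<Rightarrow> ('o, 'm, 'x) tricat_scheme \<Rightarrow>
    ('p, 'n, 'y) tricat_scheme \<Rightarrow> ('o, 'm, 'p, 'n) contra_functor \<Rightarrow>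
    ('p, 'n, 'o, 'm) contra_functor \<Rightarrow> ('o \<Rightarrow> 'm) \<Rightarrow> ('p \<Rightarrow> 'n) \<Rightarrow> bool" where
  "half_duality V T U P R i j \<longleftrightarrow>
     (\<forall>X\<in>obj T. pure_injective V U (Fo P X)) \<and>
     (\<forall>X\<in>obj T. pure_mono V T X (Fo R (Fo P X)) (i X)) \<and>
     (\<forall>X\<in>obj T. \<forall>Y\<in>obj T. \<forall>f\<in>mor T X Y. Fm R (Fm P f) \<cdot>\<^bsub>T\<^esub> i X = i Y \<cdot>\<^bsub>T\<^esub> f) \<and>
     (\<forall>X\<in>obj T. Fm P (i X) \<cdot>\<^bsub>U\<^esub> j (Fo P X) = idm U (Fo P X)) \<and>
     (\<forall>(I :: 'v set) X S \<iota>. small V I \<and> is_coproduct T I X S \<iota> \<longrightarrow>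
        (\<exists>W \<pi>. is_product U I (\<lambda>k. Fo P (X k)) W \<pi> \<and> isomorphic U (Fo P S) W))"

definition duality_triple :: "'v itself \<Rightarrow> ('o, 'm, 'x) tricat_scheme \<Rightarrow>
    ('p, 'n, 'y) tricat_scheme \<Rightarrow> ('o, 'm, 'p, 'n) contra_functor \<Rightarrow>
    ('p, 'n, 'o, 'm) contra_functor \<Rightarrow> bool" where
  "duality_triple V T U P R \<longleftrightarrow>
     compactly_generated V T \<and> compactly_generated V U \<and>
     exact_contra_functor T U P \<and> exact_contra_functor U T R \<and>
     (\<exists>i j. half_duality V T U P R i j \<and> half_duality V U T R P j i)"

end

theory Submission
  imports Defs
begin

text \<open>
  If \<open>f\<close> is phantom, then so is \<open>i Y \<cdot> f\<close>, whose codomain is pure injective. It therefore vanishes,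
  and \<open>Q f = 0\<close> because \<open>Q (i Y)\<close> has a right inverse. Conversely, \<open>Q f = 0\<close> gives \<open>i Y \<cdot> f = 0\<close> by
  naturality, and \<open>i Y\<close> can be cancelled on maps from compact objects. A triangle is pure
  exactly if its connecting map is phantom, and it splits exactly if its connecting map is zero.

  That a phantom map \<open>f\<close> into a pure injective object \<open>E\<close> vanishes is shown without Brown
  representability. Injectivity allows us to factor \<open>f\<close> as \<open>f\<^sub>1 \<cdot> u\<close> with \<open>f\<^sub>1\<close> again phantom and
  \<open>u\<close> annihilating all maps from the generators. Iteration gives a sequence \<open>X = X\<^sub>0, X\<^sub>1, \<dots>\<close>
  and a map \<open>F\<close> from its coproduct to \<open>E\<close> with \<open>F = F \<cdot> r\<close>, where \<open>r\<close> is induced by the maps \<open>u\<close>.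
  On maps from the generators, \<open>1 - r\<close> acts as the identity, so its cone is zero. Since
  \<open>F \<cdot> (1 - r) = 0\<close>, it follows that \<open>F = 0\<close>.
\<close>

section \<open>Small sets\<close>

text \<open>The delicate point is the factorization. A phantom map \<open>f\<close> from
  \<open>X\<close> to \<open>E\<close> kills the sum \<open>p\<close> of all maps from the
  generators, so it extends to a map \<open>f1\<close> on the cone \<open>Y\<close> of
  \<open>p\<close>. On maps from compact objects to \<open>Y\<close>, \<open>f1\<close> depends only
  on the composite with the connecting map \<open>w\<close> from \<open>Y\<close> to \<Sigma>S: two
  maps with the same composite differ by one that comes from \<open>X\<close>, where
  \<open>f\<close> vanishes. Thus \<open>f1\<close> induces a module map on the image of yY in
  y(\<Sigma>S), which extends to y(\<Sigma>S) because yE is injective. A module map between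
  restricted representables need not come from a morphism in general; here it does, since \<Sigma>S
  is a coproduct of compact objects. Subtracting the resulting \<open>t \<cdot> w\<close> from
  \<open>f1\<close> gives a phantom map with the same composite with \<open>u\<close>.

  The cone of \<open>1 - r\<close> is the homotopy colimit of the sequence. Its vanishing is read
  off the triangle, where maps into \<Sigma>S have to be desuspended. For this reason the set of
  generators is enlarged until it is closed under desuspension.\<close>

lemma small_lepoll: "small V B \<Longrightarrow> A \<lesssim> B \<Longrightarrow> small V A"
  unfolding small_def by (rule lesspoll_trans1)

lemma small_image: "small V A \<Longrightarrow> small V (f ` A)"
  by (erule small_lepoll) (rule image_lepoll)

lemma small_subset: "small V B \<Longrightarrow> A \<subseteq> B \<Longrightarrow> small V A"
  by (erule small_lepoll) (rule subset_imp_lepoll)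

lemma small_inj_on_image_iff: "inj_on f A \<Longrightarrow> small V (f ` A) \<longleftrightarrow> small V A"
  by (simp add: small_def)

lemma small_embedding:
  fixes V :: "'v itself"
  assumes "small V A"
  obtains e :: "'a \<Rightarrow> 'v" where "inj_on e A"
  using assms lesspoll_imp_lepoll unfolding small_def lepoll_def by blast

lemma small_countable:
  assumes "inaccessible V" "countable A"
  shows "small V A"
proof -
  have "A \<lesssim> (UNIV :: nat set)"
    using assms(2) unfolding countable_def lepoll_def by blast
  then show ?thesis
    using assms(1) unfolding inaccessible_def small_def by (blast intro: lesspoll_trans1)
qed

text \<open>Inaccessibility speaks only of unions of subsets of \<open>'v\<close> indexed by a
  subset of \<open>'v\<close>. Since \<open>'v\<close> is infinite, pairs of its elements can be
  coded by single elements, and this turns the dependent sum into a subset of such a union. The set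
  \<open>C v\<close> is the coded fibre over the index that \<open>e\<close> sends to
  \<open>v\<close>.\<close>

lemma small_Sigma:
  fixes V :: "'v itself"
  assumes V: "inaccessible V" and A: "small V A" and B: "\<And>a. a \<in> A \<Longrightarrow> small V (B a)"
  shows "small V (Sigma A B)"
proof -
  obtain e :: "'a \<Rightarrow> 'v" where e: "inj_on e A"
    using A by (rule small_embedding)
  have "\<forall>a. \<exists>d :: 'b \<Rightarrow> 'v. a \<in> A \<longrightarrow> inj_on d (B a)"
    using B small_embedding by metis
  then obtain d :: "'a \<Rightarrow> 'b \<Rightarrow> 'v" where d: "\<And>a. a \<in> A \<Longrightarrow> inj_on (d a) (B a)"
    by metis
  have "infinite (UNIV :: 'v set)"
    using V unfolding inaccessible_def by (metis infinite_le_lepoll lesspoll_imp_lepoll)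
  then have "(UNIV :: 'v set) \<times> (UNIV :: 'v set) \<approx> (UNIV :: 'v set)"
    by (simp add: eqpoll_iff_card_of_ordIso card_of_Times_same_infinite del: UNIV_Times_UNIV)
  then obtain p :: "'v \<times> 'v \<Rightarrow> 'v" where p: "inj p"
    unfolding eqpoll_def bij_betw_def by auto
  define C where "C v = (\<lambda>b. p (v, d (inv_into A e v) b)) ` B (inv_into A e v)" for v
  have "(\<Union>v\<in>e ` A. C v) \<prec> (UNIV :: 'v set)"
  proof -
    have "e ` A \<prec> (UNIV :: 'v set)"
      using small_image[OF A, of e] by (simp add: small_def)
    moreover have "C v \<prec> (UNIV :: 'v set)" if "v \<in> e ` A" for v
    proof -
      have "inv_into A e v \<in> A" using that by (rule inv_into_into)
      then have "small V (C v)" unfolding C_def by (intro small_image B)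
      then show ?thesis by (simp add: small_def)
    qed
    ultimately show ?thesis using V unfolding inaccessible_def by blast
  qed
  moreover have "(\<lambda>(a, b). p (e a, d a b)) ` Sigma A B \<subseteq> (\<Union>v\<in>e ` A. C v)"
    using e by (auto simp: C_def)
  ultimately have "small V ((\<lambda>(a, b). p (e a, d a b)) ` Sigma A B)"
    unfolding small_def by (meson lesspoll_trans1 subset_imp_lepoll)
  moreover have "inj_on (\<lambda>(a, b). p (e a, d a b)) (Sigma A B)"
  proof (rule inj_onI, clarify)
    fix a b a' b' assume *: "a \<in> A" "b \<in> B a" "a' \<in> A" "b' \<in> B a'"
      and "p (e a, d a b) = p (e a', d a' b')"
    then have "e a = e a'" "d a b = d a' b'"
      using injD[OF p] by blast+
    then show "a = a' \<and> b = b'"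
      using * inj_onD[OF e] inj_onD[OF d] by metis
  qed
  ultimately show ?thesis by (simp add: small_inj_on_image_iff)
qed


section \<open>Preadditive categories\<close>

lemma hom_inv:
  assumes "h \<in> hom G H" "group G" "group H" "x \<in> carrier G"
  shows "h (inv\<^bsub>G\<^esub> x) = inv\<^bsub>H\<^esub> h x"
proof -
  interpret group_hom G H h
    using assms by (simp add: group_hom_def group_hom_axioms_def)
  show ?thesis using assms(4) by simp
qed

text \<open>The locale assumptions list membership of the end points and of the morphism as separate
  premises. With the three bundled, typing facts can be chained with \<open>OF\<close> like the
  compositions they describe.\<close>

definition arr :: "('o, 'm, 'x) cat_scheme \<Rightarrow> 'm \<Rightarrow> 'o \<Rightarrow> 'o \<Rightarrow> bool" where
  "arr C f X Y \<longleftrightarrow> X \<in> obj C \<and> Y \<in> obj C \<and> f \<in> mor C X Y"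

lemma arrI: "\<lbrakk>X \<in> obj C; Y \<in> obj C; f \<in> mor C X Y\<rbrakk> \<Longrightarrow> arr C f X Y"
  by (simp add: arr_def)

context preadditive_category
begin

lemma arr_mor: "arr C f X Y \<Longrightarrow> f \<in> mor C X Y"
  and arr_dom: "arr C f X Y \<Longrightarrow> X \<in> obj C"
  and arr_cod: "arr C f X Y \<Longrightarrow> Y \<in> obj C"
  by (simp_all add: arr_def)

lemma arr_cmp: "\<lbrakk>arr C f X Y; arr C g Y Z\<rbrakk> \<Longrightarrow> arr C (g \<cdot> f) X Z"
  unfolding arr_def using cmp_closed by blast

lemma arr_idm: "X \<in> obj C \<Longrightarrow> arr C (idm C X) X X"
  by (simp add: arr_def idm_closed)

lemma assoc: "\<lbrakk>arr C f W X; arr C g X Y; arr C h Y Z\<rbrakk> \<Longrightarrow> (h \<cdot> g) \<cdot> f = h \<cdot> (g \<cdot> f)"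
  unfolding arr_def using cmp_assoc by blast

lemma id_right: "arr C f X Y \<Longrightarrow> f \<cdot> idm C X = f"
  and id_left: "arr C f X Y \<Longrightarrow> idm C Y \<cdot> f = f"
  unfolding arr_def using cmp_idm_right cmp_idm_left by blast+

lemma arr_zero: "\<lbrakk>X \<in> obj C; Y \<in> obj C\<rbrakk> \<Longrightarrow> arr C (zero_mor C X Y) X Y"
  by (simp add: arr_def Hom_comm_group comm_groupE(2))

lemma arr_add: "\<lbrakk>arr C f X Y; arr C g X Y\<rbrakk> \<Longrightarrow> arr C (f \<otimes>\<^bsub>Hom C X Y\<^esub> g) X Y"
  by (simp add: arr_def Hom_comm_group comm_groupE(1))

lemma Hom_group: "\<lbrakk>X \<in> obj C; Y \<in> obj C\<rbrakk> \<Longrightarrow> group (Hom C X Y)"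
  using Hom_comm_group comm_group.axioms(2) by blast

lemma arr_neg: "arr C f X Y \<Longrightarrow> arr C (inv\<^bsub>Hom C X Y\<^esub> f) X Y"
  by (simp add: arr_def Hom_group group.inv_closed)

lemma cmp_hom_right: "\<lbrakk>arr C f X Y; Z \<in> obj C\<rbrakk> \<Longrightarrow> (\<lambda>g. g \<cdot> f) \<in> hom (Hom C Y Z) (Hom C X Z)"
  unfolding arr_def hom_def using cmp_closed cmp_add_left by auto

lemma cmp_hom_left: "\<lbrakk>arr C g Y Z; X \<in> obj C\<rbrakk> \<Longrightarrow> (\<lambda>f. g \<cdot> f) \<in> hom (Hom C X Y) (Hom C X Z)"
  unfolding arr_def hom_def using cmp_closed cmp_add_right by auto

lemma zero_cmp: "\<lbrakk>arr C f X Y; Z \<in> obj C\<rbrakk> \<Longrightarrow> zero_mor C Y Z \<cdot> f = zero_mor C X Z"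
  using hom_one[OF cmp_hom_right Hom_group Hom_group] by (simp add: arr_def)

lemma cmp_zero: "\<lbrakk>arr C g Y Z; X \<in> obj C\<rbrakk> \<Longrightarrow> g \<cdot> zero_mor C X Y = zero_mor C X Z"
  using hom_one[OF cmp_hom_left Hom_group Hom_group] by (simp add: arr_def)

lemma add_cmp: "\<lbrakk>arr C f X Y; arr C g Y Z; arr C g' Y Z\<rbrakk>
    \<Longrightarrow> (g \<otimes>\<^bsub>Hom C Y Z\<^esub> g') \<cdot> f = (g \<cdot> f) \<otimes>\<^bsub>Hom C X Z\<^esub> (g' \<cdot> f)"
  unfolding arr_def using cmp_add_left by blast

lemma cmp_add: "\<lbrakk>arr C f X Y; arr C f' X Y; arr C g Y Z\<rbrakk>
    \<Longrightarrow> g \<cdot> (f \<otimes>\<^bsub>Hom C X Y\<^esub> f') = (g \<cdot> f) \<otimes>\<^bsub>Hom C X Z\<^esub> (g \<cdot> f')"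
  unfolding arr_def using cmp_add_right by blast

lemma neg_cmp: "\<lbrakk>arr C f X Y; arr C g Y Z\<rbrakk> \<Longrightarrow> (inv\<^bsub>Hom C Y Z\<^esub> g) \<cdot> f = inv\<^bsub>Hom C X Z\<^esub> (g \<cdot> f)"
  using hom_inv[OF cmp_hom_right Hom_group Hom_group] by (simp add: arr_def)

lemma cmp_neg: "\<lbrakk>arr C f X Y; arr C g Y Z\<rbrakk> \<Longrightarrow> g \<cdot> (inv\<^bsub>Hom C X Y\<^esub> f) = inv\<^bsub>Hom C X Z\<^esub> (g \<cdot> f)"
  using hom_inv[OF cmp_hom_left Hom_group Hom_group] by (simp add: arr_def)

abbreviation diff :: "'o \<Rightarrow> 'o \<Rightarrow> 'm \<Rightarrow> 'm \<Rightarrow> 'm" where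
  "diff X Y f g \<equiv> f \<otimes>\<^bsub>Hom C X Y\<^esub> inv\<^bsub>Hom C X Y\<^esub> g"

lemma arr_diff: "\<lbrakk>arr C f X Y; arr C g X Y\<rbrakk> \<Longrightarrow> arr C (diff X Y f g) X Y"
  by (intro arr_add arr_neg)

lemma diff_cmp: "\<lbrakk>arr C f X Y; arr C g Y Z; arr C g' Y Z\<rbrakk>
    \<Longrightarrow> diff Y Z g g' \<cdot> f = diff X Z (g \<cdot> f) (g' \<cdot> f)"
  by (simp add: add_cmp neg_cmp arr_neg)

lemma cmp_diff: "\<lbrakk>arr C f X Y; arr C f' X Y; arr C g Y Z\<rbrakk>
    \<Longrightarrow> g \<cdot> diff X Y f f' = diff X Z (g \<cdot> f) (g \<cdot> f')"
  by (simp add: cmp_add cmp_neg arr_neg)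

lemma diff_eq_zero_iff: "\<lbrakk>arr C f X Y; arr C g X Y\<rbrakk>
    \<Longrightarrow> diff X Y f g = zero_mor C X Y \<longleftrightarrow> f = g"
proof -
  assume f: "arr C f X Y" and g: "arr C g X Y"
  interpret G: group "Hom C X Y" using f by (simp add: arr_def Hom_group)
  show ?thesis using f g G.inv_equality[of f "inv\<^bsub>Hom C X Y\<^esub> g"] by (auto simp: arr_def)
qed

lemma diff_zero: "arr C f X Y \<Longrightarrow> diff X Y f (zero_mor C X Y) = f"
  by (simp add: arr_def Hom_group group.is_monoid monoid.inv_one monoid.r_one)

lemma zero_add_zero: "\<lbrakk>X \<in> obj C; Y \<in> obj C\<rbrakk>
    \<Longrightarrow> zero_mor C X Y \<otimes>\<^bsub>Hom C X Y\<^esub> zero_mor C X Y = zero_mor C X Y"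
  by (simp add: Hom_group group.is_monoid monoid.r_one)

lemma zero_object_to:
  assumes "zero_object C Z" "arr C f X Z"
  shows "f = zero_mor C X Z"
proof -
  have "\<exists>!f. f \<in> mor C X Z" using assms unfolding zero_object_def arr_def by blast
  then show ?thesis
    using assms arr_mor[OF arr_zero[of X Z]] unfolding arr_def by blast
qed

lemma zero_object_from:
  assumes "zero_object C Z" "arr C f Z X"
  shows "f = zero_mor C Z X"
proof -
  have "\<exists>!f. f \<in> mor C Z X" using assms unfolding zero_object_def arr_def by blast
  then show ?thesis
    using assms arr_mor[OF arr_zero[of Z X]] unfolding arr_def by blast
qed

text \<open>Every map into or out of \<open>Z\<close> equals its composite with the identity of
  \<open>Z\<close>, hence with zero.\<close>

lemma zero_objectI:
  assumes Z: "Z \<in> obj C" and 0: "idm C Z = zero_mor C Z Z"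
  shows "zero_object C Z"
proof -
  have to: "f = zero_mor C X Z" if "arr C f X Z" for f X
    using id_left[OF that] zero_cmp[OF that Z] 0 by simp
  have "from": "f = zero_mor C Z X" if "arr C f Z X" for f X
    using id_right[OF that] cmp_zero[OF that] Z 0 by simp
  show ?thesis
    unfolding zero_object_def
  proof (intro conjI ballI Z)
    fix X assume X: "X \<in> obj C"
    show "\<exists>!f. f \<in> mor C X Z"
      using arr_mor[OF arr_zero[OF X Z]] to[OF arrI[OF X Z]] by (rule ex1I)
    show "\<exists>!f. f \<in> mor C Z X"
      using arr_mor[OF arr_zero[OF Z X]] "from"[OF arrI[OF Z X]] by (rule ex1I)
  qed
qed

section \<open>Coproducts in a preadditive category and compactness\<close>

lemma coproduct_obj: "is_coproduct C I X S \<iota> \<Longrightarrow> S \<in> obj C"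
  by (simp add: is_coproduct_def)

lemma coproduct_arr: "\<lbrakk>is_coproduct C I X S \<iota>; i \<in> I\<rbrakk> \<Longrightarrow> arr C (\<iota> i) (X i) S"
  by (simp add: is_coproduct_def arr_def)

lemma coproduct_desc:
  assumes "is_coproduct C I X S \<iota>" "Z \<in> obj C" "\<And>i. i \<in> I \<Longrightarrow> arr C (f i) (X i) Z"
  obtains g where "arr C g S Z" "\<And>i. i \<in> I \<Longrightarrow> g \<cdot> \<iota> i = f i"
proof -
  have "\<forall>i\<in>I. f i \<in> mor C (X i) Z" using assms(3) by (simp add: arr_def)
  then have "\<exists>!g. g \<in> mor C S Z \<and> (\<forall>i\<in>I. g \<cdot> \<iota> i = f i)"
    using assms(1,2) unfolding is_coproduct_def by blast
  then show thesis
    using that assms(1,2) coproduct_obj unfolding arr_def by blast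
qed

lemma coproduct_ext:
  assumes S: "is_coproduct C I X S \<iota>" and g: "arr C g S Z" and g': "arr C g' S Z"
    and eq: "\<And>i. i \<in> I \<Longrightarrow> g \<cdot> \<iota> i = g' \<cdot> \<iota> i"
  shows "g = g'"
proof -
  have "\<forall>i\<in>I. g \<cdot> \<iota> i \<in> mor C (X i) Z"
    using arr_mor[OF arr_cmp[OF coproduct_arr[OF S] g]] by blast
  then have ex1: "\<exists>!h. h \<in> mor C S Z \<and> (\<forall>i\<in>I. h \<cdot> \<iota> i = g \<cdot> \<iota> i)"
    using S arr_cod[OF g] unfolding is_coproduct_def by auto
  show ?thesis
    using the1_equality[OF ex1, of g] the1_equality[OF ex1, of g'] arr_mor[OF g] arr_mor[OF g'] eq
    by simp
qed

lemma coproductI: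
  assumes "S \<in> obj C" "\<And>i. i \<in> I \<Longrightarrow> arr C (\<iota> i) (X i) S"
    and desc: "\<And>Z f. \<lbrakk>Z \<in> obj C; \<And>i. i \<in> I \<Longrightarrow> arr C (f i) (X i) Z\<rbrakk>
      \<Longrightarrow> \<exists>g. arr C g S Z \<and> (\<forall>i\<in>I. g \<cdot> \<iota> i = f i)"
    and ext: "\<And>Z g g'. \<lbrakk>arr C g S Z; arr C g' S Z; \<And>i. i \<in> I \<Longrightarrow> g \<cdot> \<iota> i = g' \<cdot> \<iota> i\<rbrakk> \<Longrightarrow> g = g'"
  shows "is_coproduct C I X S \<iota>"
  unfolding is_coproduct_def
proof (intro conjI ballI allI impI)
  fix Z f assume Z: "Z \<in> obj C" and f: "\<forall>i\<in>I. f i \<in> mor C (X i) Z"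
  have "\<exists>g. arr C g S Z \<and> (\<forall>i\<in>I. g \<cdot> \<iota> i = f i)"
    using f assms(2) Z by (intro desc) (auto simp: arr_def)
  then obtain g where g: "arr C g S Z" "\<forall>i\<in>I. g \<cdot> \<iota> i = f i" by blast
  show "\<exists>!g. g \<in> mor C S Z \<and> (\<forall>i\<in>I. g \<cdot> \<iota> i = f i)"
  proof (rule ex1I[of _ g])
    show "g \<in> mor C S Z \<and> (\<forall>i\<in>I. g \<cdot> \<iota> i = f i)" using g by (simp add: arr_def)
    fix h assume "h \<in> mor C S Z \<and> (\<forall>i\<in>I. h \<cdot> \<iota> i = f i)"
    then show "h = g" using g Z assms(1) by (intro ext[of h Z g]) (simp_all add: arr_def)
  qed
qed (use assms(1,2) in \<open>auto simp: arr_def\<close>)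

text \<open>Existence of coproducts and compactness are formulated for index sets inside
  \<open>'v\<close> only. Reindexing along an embedding into \<open>'v\<close>, or along its
  inverse, carries them over to index sets of other types, such as sets of morphisms.\<close>

lemma coproduct_reindex:
  assumes e: "inj_on e K" and S: "is_coproduct C (e ` K) X S \<iota>" and X: "\<And>k. k \<in> K \<Longrightarrow> X (e k) = Y k"
  shows "is_coproduct C K Y S (\<lambda>k. \<iota> (e k))"
proof (rule coproductI)
  show "S \<in> obj C" using S by (rule coproduct_obj)
  show "arr C (\<iota> (e i)) (Y i) S" if "i \<in> K" for i
    using coproduct_arr[OF S, of "e i"] X that by simp
  show "\<exists>g. arr C g S Z \<and> (\<forall>i\<in>K. g \<cdot> \<iota> (e i) = f i)"
    if Z: "Z \<in> obj C" and f: "\<And>i. i \<in> K \<Longrightarrow> arr C (f i) (Y i) Z" for Z f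
  proof -
    obtain g where g: "arr C g S Z" "\<And>i. i \<in> e ` K \<Longrightarrow> g \<cdot> \<iota> i = f (inv_into K e i)"
      by (rule coproduct_desc[OF S Z, of "\<lambda>i. f (inv_into K e i)"]) (use X f e in auto)
    then show ?thesis using e by auto
  qed
  show "g = g'" if "arr C g S Z" "arr C g' S Z" "\<And>i. i \<in> K \<Longrightarrow> g \<cdot> \<iota> (e i) = g' \<cdot> \<iota> (e i)" for Z g g'
    by (rule coproduct_ext[OF S that(1,2)]) (use that(3) in auto)
qed

lemma small_coproduct:
  fixes V :: "'v itself" and K :: "'k set"
  assumes C: "has_small_coproducts V C" and K: "small V K" and Y: "\<And>k. k \<in> K \<Longrightarrow> Y k \<in> obj C"
  obtains S \<iota> where "is_coproduct C K Y S \<iota>"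
proof -
  obtain e :: "'k \<Rightarrow> 'v" where e: "inj_on e K"
    using K by (rule small_embedding)
  have "small V (e ` K) \<and> (\<forall>i\<in>e ` K. Y (inv_into K e i) \<in> obj C)"
    using e Y small_image[OF K] by auto
  then obtain S \<iota> where "is_coproduct C (e ` K) (\<lambda>i. Y (inv_into K e i)) S \<iota>"
    using C[unfolded has_small_coproducts_def, THEN spec[of _ "e ` K"],
        THEN spec[of _ "\<lambda>i. Y (inv_into K e i)"]] by blast
  then show thesis
    by (rule that[OF coproduct_reindex[OF e]]) (simp add: e)
qed

text \<open>The map \<open>b\<close> is induced by the \<open>a i\<close> and \<open>c\<close> by
  their inverses. It serves to replace a coproduct of arbitrary objects by one of suspended
  objects.\<close>

lemma coproduct_iso:
  assumes S: "is_coproduct C I X S \<iota>" and S': "is_coproduct C I X' S' \<iota>'"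
    and a: "\<And>i. i \<in> I \<Longrightarrow> iso_mor C (X' i) (X i) (a i)"
  obtains b c where "arr C b S' S" "arr C c S S'" "b \<cdot> c = idm C S"
    "\<And>i. i \<in> I \<Longrightarrow> b \<cdot> \<iota>' i = \<iota> i \<cdot> a i"
proof -
  have "\<exists>d. arr C d (X i) (X' i) \<and> a i \<cdot> d = idm C (X i)" if "i \<in> I" for i
    using a[OF that] arr_dom[OF coproduct_arr[OF S that]] arr_dom[OF coproduct_arr[OF S' that]]
    unfolding iso_mor_def arr_def by blast
  then obtain d where d: "\<And>i. i \<in> I \<Longrightarrow> arr C (d i) (X i) (X' i)"
      "\<And>i. i \<in> I \<Longrightarrow> a i \<cdot> d i = idm C (X i)"
    by metis
  have a': "arr C (a i) (X' i) (X i)" if "i \<in> I" for i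
    using a[OF that] d(1)[OF that] by (simp add: arr_def iso_mor_def)
  obtain b where b: "arr C b S' S" "\<And>i. i \<in> I \<Longrightarrow> b \<cdot> \<iota>' i = \<iota> i \<cdot> a i"
    by (rule coproduct_desc[OF S' coproduct_obj[OF S], of "\<lambda>i. \<iota> i \<cdot> a i"])
      (auto intro: arr_cmp a' coproduct_arr[OF S])
  obtain c where c: "arr C c S S'" "\<And>i. i \<in> I \<Longrightarrow> c \<cdot> \<iota> i = \<iota>' i \<cdot> d i"
    by (rule coproduct_desc[OF S coproduct_obj[OF S'], of "\<lambda>i. \<iota>' i \<cdot> d i"])
      (auto intro: arr_cmp d coproduct_arr[OF S'])
  have "b \<cdot> c = idm C S"
  proof (rule coproduct_ext[OF S arr_cmp[OF c(1) b(1)] arr_idm[OF coproduct_obj[OF S]]])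
    fix i assume i: "i \<in> I"
    note \<iota> = coproduct_arr[OF S i] and \<iota>' = coproduct_arr[OF S' i]
    have "(b \<cdot> c) \<cdot> \<iota> i = (b \<cdot> \<iota>' i) \<cdot> d i"
      by (simp add: assoc[OF \<iota> c(1) b(1)] c(2)[OF i] assoc[OF d(1)[OF i] \<iota>' b(1)])
    also have "\<dots> = \<iota> i"
      by (simp add: b(2)[OF i] assoc[OF d(1)[OF i] a'[OF i] \<iota>] d(2)[OF i] id_right[OF \<iota>])
    finally show "(b \<cdot> c) \<cdot> \<iota> i = idm C S \<cdot> \<iota> i" by (simp add: id_left[OF \<iota>])
  qed
  then show thesis using that b c by blast
qed

end

text \<open>
  In a coproduct the components of a family are recovered through projections, so that only
  surjectivity is at stake in the definition of compactness. This reformulates surjectivity as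
  an induction principle for morphisms into a coproduct.
\<close>

definition compact_induct :: "'v itself \<Rightarrow> ('o, 'm, 'x) cat_scheme \<Rightarrow> 'o \<Rightarrow> bool" where
  "compact_induct V C D \<longleftrightarrow> D \<in> obj C \<and>
     (\<forall>(I :: 'v set) X S \<iota> H. small V I \<and> is_coproduct C I X S \<iota> \<and> zero_mor C D S \<in> H \<and>
        (\<forall>a b. a \<in> H \<longrightarrow> b \<in> H \<longrightarrow> arr C a D S \<longrightarrow> arr C b D S \<longrightarrow> a \<otimes>\<^bsub>Hom C D S\<^esub> b \<in> H) \<and>
        (\<forall>i\<in>I. \<forall>x. arr C x D (X i) \<longrightarrow> \<iota> i \<cdot>\<^bsub>C\<^esub> x \<in> H) \<longrightarrow> mor C D S \<subseteq> H)"

context preadditive_category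
begin

lemma coproduct_sum_hom:
  assumes D: "D \<in> obj C" and S: "is_coproduct C I X S \<iota>"
  shows "(\<lambda>x. gfinprod (Hom C D S) (\<lambda>i. \<iota> i \<cdot> x i) I)
    \<in> hom (sum_group I (\<lambda>i. Hom C D (X i))) (Hom C D S)"
proof -
  interpret comm_group "Hom C D S"
    using D coproduct_obj[OF S] by (rule Hom_comm_group)
  show ?thesis
    using coproduct_arr[OF S] D
    by (intro hom_group_sum cmp_hom_left) (auto intro!: Hom_group simp: arr_def)
qed

lemma carrier_coproduct_sum:
  assumes D: "D \<in> obj C" and S: "is_coproduct C I X S \<iota>"
  shows "carrier (sum_group I (\<lambda>i. Hom C D (X i))) =
    {x \<in> \<Pi>\<^sub>E i\<in>I. mor C D (X i). finite {i \<in> I. x i \<noteq> zero_mor C D (X i)}}"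
  using D coproduct_arr[OF S] by (intro carrier_sum_group Hom_group) (auto simp: arr_def)

lemma compact_imp_compact_induct:
  fixes V :: "'v itself"
  assumes "compact_object V C D"
  shows "compact_induct V C D"
  unfolding compact_induct_def
proof (intro conjI allI impI subsetI)
  show D: "D \<in> obj C" using assms by (simp add: compact_object_def)
  fix I :: "'v set" and X S \<iota> H g
  assume *: "small V I \<and> is_coproduct C I X S \<iota> \<and> zero_mor C D S \<in> H \<and>
    (\<forall>a b. a \<in> H \<longrightarrow> b \<in> H \<longrightarrow> arr C a D S \<longrightarrow> arr C b D S \<longrightarrow> a \<otimes>\<^bsub>Hom C D S\<^esub> b \<in> H) \<and>
    (\<forall>i\<in>I. \<forall>x. arr C x D (X i) \<longrightarrow> \<iota> i \<cdot> x \<in> H)" and g: "g \<in> mor C D S"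
  have I: "small V I" and S: "is_coproduct C I X S \<iota>" and H0: "zero_mor C D S \<in> H"
    and Hadd: "\<forall>a b. a \<in> H \<longrightarrow> b \<in> H \<longrightarrow> arr C a D S \<longrightarrow> arr C b D S \<longrightarrow> a \<otimes>\<^bsub>Hom C D S\<^esub> b \<in> H"
    and H\<iota>: "\<forall>i\<in>I. \<forall>x. arr C x D (X i) \<longrightarrow> \<iota> i \<cdot> x \<in> H"
    using * by blast+
  interpret comm_group "Hom C D S"
    using D coproduct_obj[OF S] by (rule Hom_comm_group)
  have "(\<lambda>x. gfinprod (Hom C D S) (\<lambda>i. \<iota> i \<cdot> x i) I) \<in> iso (sum_group I (\<lambda>i. Hom C D (X i))) (Hom C D S)"
    using assms I S unfolding compact_object_def by blast
  then obtain x where x: "x \<in> carrier (sum_group I (\<lambda>i. Hom C D (X i)))"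
    and gx: "g = gfinprod (Hom C D S) (\<lambda>i. \<iota> i \<cdot> x i) I"
    using g unfolding iso_def bij_betw_def by blast
  have arrx: "arr C (x i) D (X i)" if "i \<in> I" for i
    using x that D coproduct_arr[OF S that] by (auto simp: carrier_coproduct_sum[OF D S] arr_def)
  have arr\<iota>: "arr C (\<iota> i \<cdot> x i) D S" if "i \<in> I" for i
    using arrx[OF that] coproduct_arr[OF S that] by (rule arr_cmp)
  have "finprod (Hom C D S) (\<lambda>i. \<iota> i \<cdot> x i) J \<in> H" if "finite J" "J \<subseteq> I" for J
    using that
  proof (induction J)
    case (insert i J)
    have "(\<lambda>i. \<iota> i \<cdot> x i) \<in> J \<rightarrow> mor C D S"
      using insert.prems arr\<iota> by (auto simp: arr_def)
    moreover have "arr C (finprod (Hom C D S) (\<lambda>i. \<iota> i \<cdot> x i) J) D S"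
      using calculation D coproduct_obj[OF S] by (simp add: arr_def)
    moreover have "\<iota> i \<cdot> x i \<in> H"
      using insert.prems H\<iota> arrx by auto
    ultimately show ?case
      using insert arr\<iota>[of i] Hadd by (simp add: arr_mor)
  qed (simp add: H0)
  \<comment> \<open>\<open>gfinprod\<close> is the product over the support, or the unit when the
    support is infinite; \<open>H0\<close> settles the second case.\<close>
  then show "g \<in> H"
    unfolding gx gfinprod_def using H0 by auto
qed

lemma coproduct_projection:
  assumes S: "is_coproduct C I X S \<iota>" and k: "k \<in> I"
  obtains p where "arr C p S (X k)" "p \<cdot> \<iota> k = idm C (X k)"
    "\<And>i. i \<in> I \<Longrightarrow> i \<noteq> k \<Longrightarrow> p \<cdot> \<iota> i = zero_mor C (X i) (X k)"
proof -
  have obj: "X i \<in> obj C" if "i \<in> I" for i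
    using coproduct_arr[OF S that] by (rule arr_dom)
  obtain p where p: "arr C p S (X k)"
      "\<And>i. i \<in> I \<Longrightarrow> p \<cdot> \<iota> i = (if i = k then idm C (X k) else zero_mor C (X i) (X k))"
    by (rule coproduct_desc[OF S obj[OF k], of "\<lambda>i. if i = k then idm C (X k) else zero_mor C (X i) (X k)"])
      (auto intro: arr_idm arr_zero obj k)
  then show thesis using that k by simp
qed

text \<open>The projection to the \<open>k\<close>-th summand annihilates every other term of the
  finite sum and returns \<open>x k\<close>. So if the sum vanishes, each component does. No
  compactness enters.\<close>

lemma coproduct_sum_inj:
  assumes D: "D \<in> obj C" and S: "is_coproduct C I X S \<iota>"
  shows "inj_on (\<lambda>x. gfinprod (Hom C D S) (\<lambda>i. \<iota> i \<cdot> x i) I)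
    (carrier (sum_group I (\<lambda>i. Hom C D (X i))))"
proof -
  interpret Hom: comm_group "Hom C D S"
    using D coproduct_obj[OF S] by (rule Hom_comm_group)
  have grp: "group (Hom C D (X i))" if "i \<in> I" for i
    using D coproduct_arr[OF S that] by (auto intro: Hom_group simp: arr_def)
  interpret group_hom "sum_group I (\<lambda>i. Hom C D (X i))" "Hom C D S"
      "\<lambda>x. gfinprod (Hom C D S) (\<lambda>i. \<iota> i \<cdot> x i) I"
    using coproduct_sum_hom[OF D S] grp
    by (simp add: group_hom_def group_hom_axioms_def Hom.is_group)
  show ?thesis
  proof (unfold inj_on_one_iff, intro allI impI)
    fix x assume x: "x \<in> carrier (sum_group I (\<lambda>i. Hom C D (X i)))"
      and 0: "gfinprod (Hom C D S) (\<lambda>i. \<iota> i \<cdot> x i) I = zero_mor C D S"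
    have arrx: "arr C (x i) D (X i)" if "i \<in> I" for i
      using x that D coproduct_arr[OF S that] by (auto simp: carrier_coproduct_sum[OF D S] arr_def)
    have arr\<iota>: "arr C (\<iota> i \<cdot> x i) D S" if "i \<in> I" for i
      using arrx[OF that] coproduct_arr[OF S that] by (rule arr_cmp)
    have fin: "finite {i \<in> I. x i \<noteq> zero_mor C D (X i)}"
      using x by (simp add: carrier_coproduct_sum[OF D S])
    have "x k = zero_mor C D (X k)" if k: "k \<in> I" for k
    proof -
      obtain p where p: "arr C p S (X k)" "p \<cdot> \<iota> k = idm C (X k)"
          "\<And>i. i \<in> I \<Longrightarrow> i \<noteq> k \<Longrightarrow> p \<cdot> \<iota> i = zero_mor C (X i) (X k)"
        by (rule coproduct_projection[OF S k]) blast
      \<comment> \<open>The index \<open>k\<close> is split off whether or not its term is zero, so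
        that the sum is always the \<open>k\<close>-th term plus the sum over
        \<open>J\<close>.\<close>
      define J where "J = {i \<in> I. \<iota> i \<cdot> x i \<noteq> zero_mor C D S} - {k}"
      have "J \<subseteq> {i \<in> I. x i \<noteq> zero_mor C D (X i)}"
        using cmp_zero[OF coproduct_arr[OF S] D] by (auto simp: J_def)
      then have J: "finite J" "J \<subseteq> I" "k \<notin> J"
        using fin by (auto simp: J_def dest: finite_subset)
      have carr: "(\<lambda>i. \<iota> i \<cdot> x i) \<in> I \<rightarrow> mor C D S"
        using arr\<iota> by (auto simp: arr_def)
      have "gfinprod (Hom C D S) (\<lambda>i. \<iota> i \<cdot> x i) (insert k J) = gfinprod (Hom C D S) (\<lambda>i. \<iota> i \<cdot> x i) I"
        by (rule Hom.gfinprod_mono_neutral_cong_left) (use J k carr in \<open>auto simp: J_def\<close>)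
      then have "finprod (Hom C D S) (\<lambda>i. \<iota> i \<cdot> x i) (insert k J) = zero_mor C D S"
        using J k carr 0 by (subst (asm) Hom.gfinprod_eq_finprod) auto
      then have sum: "(\<iota> k \<cdot> x k) \<otimes>\<^bsub>Hom C D S\<^esub> finprod (Hom C D S) (\<lambda>i. \<iota> i \<cdot> x i) J = zero_mor C D S"
        using J k carr arr_mor[OF arr\<iota>[OF k]] by (subst (asm) Hom.finprod_insert) auto
      have rest: "arr C (finprod (Hom C D S) (\<lambda>i. \<iota> i \<cdot> x i) J) D S \<and>
          p \<cdot> finprod (Hom C D S) (\<lambda>i. \<iota> i \<cdot> x i) J = zero_mor C D (X k)"
        using J
      proof (induction J)
        case empty
        then show ?case using cmp_zero[OF p(1) D] arr_zero[OF D coproduct_obj[OF S]] by simp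
      next
        case (insert i J)
        then have i: "i \<in> I" "i \<noteq> k" and IH: "arr C (finprod (Hom C D S) (\<lambda>i. \<iota> i \<cdot> x i) J) D S"
            "p \<cdot> finprod (Hom C D S) (\<lambda>i. \<iota> i \<cdot> x i) J = zero_mor C D (X k)" by auto
        have eq: "finprod (Hom C D S) (\<lambda>i. \<iota> i \<cdot> x i) (insert i J)
            = (\<iota> i \<cdot> x i) \<otimes>\<^bsub>Hom C D S\<^esub> finprod (Hom C D S) (\<lambda>i. \<iota> i \<cdot> x i) J"
          by (rule Hom.finprod_insert) (use insert carr arr_mor[OF arr\<iota>[OF i(1)]] in auto)
        have "p \<cdot> (\<iota> i \<cdot> x i) = (p \<cdot> \<iota> i) \<cdot> x i"
          by (rule assoc[OF arrx[OF i(1)] coproduct_arr[OF S i(1)] p(1), symmetric])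
        also have "\<dots> = zero_mor C D (X k)"
          using p(3)[OF i] zero_cmp[OF arrx[OF i(1)] arr_cod[OF p(1)]] by simp
        finally show ?case
          unfolding eq using IH arr\<iota>[OF i(1)] p(1)
          by (simp add: cmp_add[OF arr\<iota>[OF i(1)] IH(1) p(1)] arr_add zero_add_zero D arr_cod[OF p(1)])
      qed
      have "x k = p \<cdot> (\<iota> k \<cdot> x k)"
        using assoc[OF arrx[OF k] coproduct_arr[OF S k] p(1)] p(2) id_left[OF arrx[OF k]] by simp
      also have "\<dots> = (p \<cdot> (\<iota> k \<cdot> x k)) \<otimes>\<^bsub>Hom C D (X k)\<^esub> (p \<cdot> finprod (Hom C D S) (\<lambda>i. \<iota> i \<cdot> x i) J)"
        using arr_mor[OF arr_cmp[OF arr\<iota>[OF k] p(1)]] grp[OF k] rest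
        by (simp add: group.is_monoid monoid.r_one)
      also have "\<dots> = p \<cdot> zero_mor C D S"
        using cmp_add[OF arr\<iota>[OF k] conjunct1[OF rest] p(1)] rest sum by simp
      finally show ?thesis using cmp_zero[OF p(1) D] by simp
    qed
    moreover have "x \<in> extensional I"
      using x by (simp add: carrier_coproduct_sum[OF D S] PiE_def)
    ultimately show "x = \<one>\<^bsub>sum_group I (\<lambda>i. Hom C D (X i))\<^esub>"
      by (auto simp: extensional_def restrict_def)
  qed
qed

text \<open>The induction principle is applied to the image of the comparison map. The image is a
  subgroup that contains all maps through a single summand, hence it is everything.\<close>

lemma compact_induct_imp_compact:
  fixes V :: "'v itself"
  assumes "compact_induct V C D"
  shows "compact_object V C D"
  unfolding compact_object_def
proof (intro conjI allI impI)
  show D: "D \<in> obj C" using assms by (simp add: compact_induct_def)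
  fix I :: "'v set" and X S \<iota>
  assume *: "small V I \<and> is_coproduct C I X S \<iota>"
  then have I: "small V I" and S: "is_coproduct C I X S \<iota>" by blast+
  define h where "h x = gfinprod (Hom C D S) (\<lambda>i. \<iota> i \<cdot> x i) I" for x
  define G where "G = sum_group I (\<lambda>i. Hom C D (X i))"
  interpret Hom: comm_group "Hom C D S"
    using D coproduct_obj[OF S] by (rule Hom_comm_group)
  have obj: "X i \<in> obj C" if "i \<in> I" for i
    using coproduct_arr[OF S that] by (rule arr_dom)
  have G: "group G" unfolding G_def by (intro sum_group Hom_group D obj)
  have hom: "h \<in> hom G (Hom C D S)" and inj: "inj_on h (carrier G)"
    using coproduct_sum_hom[OF D S] coproduct_sum_inj[OF D S] unfolding h_def G_def by simp_all
  interpret group_hom G "Hom C D S" h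
    using hom G
    by (simp add: group_hom_def group_hom_axioms_def Hom.is_group)
  have "mor C D S \<subseteq> h ` carrier G"
  proof -
    have "zero_mor C D S \<in> h ` carrier G"
      by (metis hom_one G.one_closed imageI)
    moreover have "a \<otimes>\<^bsub>Hom C D S\<^esub> b \<in> h ` carrier G" if a: "a \<in> h ` carrier G" and b: "b \<in> h ` carrier G" for a b
    proof -
      obtain x where x: "a = h x" "x \<in> carrier G" using a by (rule imageE)
      obtain y where y: "b = h y" "y \<in> carrier G" using b by (rule imageE)
      have "a \<otimes>\<^bsub>Hom C D S\<^esub> b = h (x \<otimes>\<^bsub>G\<^esub> y)" using x y by simp
      then show ?thesis using G.m_closed[OF x(2) y(2)] by (rule image_eqI)
    qed
    moreover have "\<iota> i \<cdot> x \<in> h ` carrier G" if i: "i \<in> I" and x: "arr C x D (X i)" for i x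
    proof
      \<comment> \<open>The family concentrated at \<open>i\<close>. It is restricted to
        \<open>I\<close> because the carrier of \<open>sum_group\<close> consists of extensional
        functions.\<close>
      let ?x = "\<lambda>j\<in>I. if j = i then x else zero_mor C D (X j)"
      have "{j \<in> I. ?x j \<noteq> zero_mor C D (X j)} \<subseteq> {i}" by auto
      then have "finite {j \<in> I. ?x j \<noteq> zero_mor C D (X j)}" by (rule finite_subset) simp
      moreover have "?x \<in> (\<Pi>\<^sub>E i\<in>I. mor C D (X i))"
        using x arr_mor[OF arr_zero[OF D obj]] by (auto simp: arr_def)
      ultimately show "?x \<in> carrier G"
        by (simp add: carrier_coproduct_sum[OF D S] G_def)
      have \<iota>x: "\<iota> i \<cdot> x \<in> mor C D S"
        using arr_cmp[OF x coproduct_arr[OF S i]] by (rule arr_mor)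
      have "h ?x = gfinprod (Hom C D S) (\<lambda>j. \<iota> j \<cdot> ?x j) I"
        by (rule h_def)
      also have "\<dots> = gfinprod (Hom C D S) (\<lambda>j. \<iota> j \<cdot> ?x j) {i}"
      proof (rule Hom.gfinprod_mono_neutral_cong_left[symmetric])
        show 0: "\<iota> j \<cdot> ?x j = zero_mor C D S" if "j \<in> I - {i}" for j
          using that cmp_zero[OF coproduct_arr[OF S] D] by auto
        show "(\<lambda>j. \<iota> j \<cdot> ?x j) \<in> I \<rightarrow> mor C D S"
        proof
          fix j assume "j \<in> I"
          then show "\<iota> j \<cdot> ?x j \<in> mor C D S"
            using \<iota>x 0[of j] Hom.one_closed by (cases "j = i") auto
        qed
      qed (use i in auto)
      also have "\<dots> = \<iota> i \<cdot> x"
        using \<iota>x i by (subst Hom.gfinprod_eq_finprod) auto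
      finally show "\<iota> i \<cdot> x = h ?x" by simp
    qed
    ultimately show ?thesis
      using assms[unfolded compact_induct_def, THEN conjunct2, THEN spec[of _ I],
          THEN spec[of _ X], THEN spec[of _ S], THEN spec[of _ \<iota>],
          THEN spec[of _ "h ` carrier G"]] I S by blast
  qed
  then have "h ` carrier G = mor C D S"
    using hom by (auto simp: hom_def)
  then have "h \<in> iso G (Hom C D S)"
    using hom inj by (simp add: iso_def bij_betw_def)
  then show "(\<lambda>x. gfinprod (Hom C D S) (\<lambda>i. \<iota> i \<cdot> x i) I)
      \<in> iso (sum_group I (\<lambda>i. Hom C D (X i))) (Hom C D S)"
    unfolding h_def G_def .
qed

lemma compact_object_iff: "compact_object V C D \<longleftrightarrow> compact_induct V C D"
  using compact_imp_compact_induct compact_induct_imp_compact by blast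

lemma compact_obj: "compact_object V C D \<Longrightarrow> D \<in> obj C"
  by (simp add: compact_object_def)

lemma compact_inductI:
  fixes V :: "'v itself"
  assumes "D \<in> obj C"
    and "\<And>(I :: 'v set) X S \<iota> H g. \<lbrakk>small V I; is_coproduct C I X S \<iota>; zero_mor C D S \<in> H;
        \<And>a b. \<lbrakk>a \<in> H; b \<in> H; arr C a D S; arr C b D S\<rbrakk> \<Longrightarrow> a \<otimes>\<^bsub>Hom C D S\<^esub> b \<in> H;
        \<And>i x. \<lbrakk>i \<in> I; arr C x D (X i)\<rbrakk> \<Longrightarrow> \<iota> i \<cdot> x \<in> H; arr C g D S\<rbrakk> \<Longrightarrow> g \<in> H"
  shows "compact_object V C D"
  unfolding compact_object_iff compact_induct_def
proof (intro conjI allI impI subsetI)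
  fix I :: "'v set" and X S \<iota> H g
  assume *: "small V I \<and> is_coproduct C I X S \<iota> \<and> zero_mor C D S \<in> H \<and>
    (\<forall>a b. a \<in> H \<longrightarrow> b \<in> H \<longrightarrow> arr C a D S \<longrightarrow> arr C b D S \<longrightarrow> a \<otimes>\<^bsub>Hom C D S\<^esub> b \<in> H) \<and>
    (\<forall>i\<in>I. \<forall>x. arr C x D (X i) \<longrightarrow> \<iota> i \<cdot> x \<in> H)" and "g \<in> mor C D S"
  then have "arr C g D S"
    using assms(1) coproduct_obj by (auto simp: arr_def)
  then show "g \<in> H"
    using * by (intro assms(2)[of I X S \<iota> H g]) blast+
qed (rule assms(1))

text \<open>This is the form in which compactness is used from here on: a property of maps from
  \<open>D\<close> into a small coproduct, over an index set of any type, may be checked on maps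
  through one summand if it holds for zero and passes to sums.\<close>

lemma compact_into_coproduct:
  fixes V :: "'v itself" and K :: "'k set"
  assumes D: "compact_object V C D" and K: "small V K" and S: "is_coproduct C K Y S \<iota>"
    and g: "arr C g D S" and zero: "H (zero_mor C D S)"
    and add: "\<And>a b. \<lbrakk>H a; H b; arr C a D S; arr C b D S\<rbrakk> \<Longrightarrow> H (a \<otimes>\<^bsub>Hom C D S\<^esub> b)"
    and incl: "\<And>k x. \<lbrakk>k \<in> K; arr C x D (Y k)\<rbrakk> \<Longrightarrow> H (\<iota> k \<cdot> x)"
  shows "H g"
proof -
  obtain e :: "'k \<Rightarrow> 'v" where e: "inj_on e K"
    using K by (rule small_embedding)
  let ?d = "inv_into K e"
  have eK: "?d ` e ` K = K" using e by (simp add: image_image)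
  have "is_coproduct C (e ` K) (\<lambda>i. Y (?d i)) S (\<lambda>i. \<iota> (?d i))"
    by (rule coproduct_reindex[where X = Y and e = ?d and \<iota> = \<iota>]) (simp_all only: eK inj_on_inv_into S order_refl)
  moreover have "small V (e ` K)" using K by (rule small_image)
  moreover have "\<forall>i\<in>e ` K. \<forall>x. arr C x D (Y (?d i)) \<longrightarrow> \<iota> (?d i) \<cdot> x \<in> Collect H"
    using e incl by auto
  moreover have "zero_mor C D S \<in> Collect H"
    and "\<forall>a b. a \<in> Collect H \<longrightarrow> b \<in> Collect H \<longrightarrow> arr C a D S \<longrightarrow> arr C b D S
      \<longrightarrow> a \<otimes>\<^bsub>Hom C D S\<^esub> b \<in> Collect H"
    using zero add by auto
  ultimately have "mor C D S \<subseteq> Collect H"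
    using D[unfolded compact_object_iff compact_induct_def, THEN conjunct2, THEN spec[of _ "e ` K"],
        THEN spec[of _ "\<lambda>i. Y (?d i)"], THEN spec[of _ S], THEN spec[of _ "\<lambda>i. \<iota> (?d i)"],
        THEN spec[of _ "Collect H"]] by blast
  then show ?thesis using arr_mor[OF g] by blast
qed

end

section \<open>Triangulated categories\<close>

context triangulated_category
begin

lemma arr_sh: "arr T f X Y \<Longrightarrow> arr T (sh T f) (Sh T X) (Sh T Y)"
  using sh_iso[of X Y] by (auto simp: arr_def Sh_closed iso_def hom_def)

lemma sh_cmp_arr: "\<lbrakk>arr T f X Y; arr T g Y Z\<rbrakk> \<Longrightarrow> sh T (g \<cdot> f) = sh T g \<cdot> sh T f"
  unfolding arr_def using sh_cmp by blast

lemma sh_inj: "\<lbrakk>arr T f X Y; arr T g X Y; sh T f = sh T g\<rbrakk> \<Longrightarrow> f = g"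
  using sh_iso[of X Y] by (auto simp: arr_def iso_def bij_betw_def dest: inj_onD)

lemma sh_full:
  assumes "X \<in> obj T" "Y \<in> obj T" "arr T w (Sh T X) (Sh T Y)"
  obtains x where "arr T x X Y" "sh T x = w"
proof -
  have "w \<in> sh T ` mor T X Y"
    using sh_iso[OF assms(1,2)] assms(3) by (simp add: arr_def iso_def bij_betw_def)
  then show thesis using that assms(1,2) by (auto simp: arr_def)
qed

lemma sh_hom: "\<lbrakk>X \<in> obj T; Y \<in> obj T\<rbrakk> \<Longrightarrow> sh T \<in> hom (Hom T X Y) (Hom T (Sh T X) (Sh T Y))"
  using sh_iso by (auto simp: iso_def)

lemma sh_zero: "\<lbrakk>X \<in> obj T; Y \<in> obj T\<rbrakk> \<Longrightarrow> sh T (zero_mor T X Y) = zero_mor T (Sh T X) (Sh T Y)"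
  by (rule hom_one[OF sh_hom]) (simp_all add: Hom_group Sh_closed)

lemma sh_add: "\<lbrakk>arr T f X Y; arr T g X Y\<rbrakk>
    \<Longrightarrow> sh T (f \<otimes>\<^bsub>Hom T X Y\<^esub> g) = sh T f \<otimes>\<^bsub>Hom T (Sh T X) (Sh T Y)\<^esub> sh T g"
  using hom_mult[OF sh_hom] by (simp add: arr_def)

lemma zero_object_Sh:
  assumes "zero_object T Z"
  shows "zero_object T (Sh T Z)"
proof (rule zero_objectI)
  have Z: "Z \<in> obj T" using assms by (simp add: zero_object_def)
  then show "Sh T Z \<in> obj T" by (rule Sh_closed)
  have "idm T Z = zero_mor T Z Z" using assms arr_idm[OF Z] by (rule zero_object_to)
  then show "idm T (Sh T Z) = zero_mor T (Sh T Z) (Sh T Z)"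
    using sh_idm[OF Z] sh_zero[OF Z Z] by simp
qed

text \<open>The shift need not be surjective on objects, so an object is a suspension only up to
  isomorphism. The maps \<open>a\<close> and \<open>b\<close> have to accompany every argument that
  undoes a shift.\<close>

lemma desuspension:
  assumes "Y \<in> obj T"
  obtains X a b where "arr T a (Sh T X) Y" "arr T b Y (Sh T X)" "X \<in> obj T"
    "a \<cdot> b = idm T Y" "b \<cdot> a = idm T (Sh T X)"
  using Sh_ess_surj[OF assms] unfolding isomorphic_def iso_mor_def arr_def by blast

section \<open>Exactness of the Hom functors on triangles\<close>

lemma triangle_arr:
  assumes "triangle T X Y Z f g h"
  shows "arr T f X Y" "arr T g Y Z" "arr T h Z (Sh T X)"
  using triangle_candidate[OF assms] by (auto simp: candidate_triangle_def arr_def Sh_closed)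

lemma triangle_rot: "triangle T X Y Z f g h \<Longrightarrow>
    triangle T Y Z (Sh T X) g h (inv\<^bsub>Hom T (Sh T X) (Sh T Y)\<^esub> (sh T f))"
  using triangle_rotate triangle_candidate by blast

lemma neg_cmp_zero_iff:
  assumes "arr T f X Y" "arr T g Y Z"
  shows "inv\<^bsub>Hom T Y Z\<^esub> g \<cdot> f = zero_mor T X Z \<longleftrightarrow> g \<cdot> f = zero_mor T X Z"
proof -
  interpret G: group "Hom T X Z" using assms by (simp add: arr_def Hom_group)
  show ?thesis
    using arr_mor[OF arr_cmp[OF assms]] by (simp add: neg_cmp[OF assms])
qed

text \<open>The identity triangle of \<open>X\<close> maps to the given one by the identity of
  \<open>X\<close> and \<open>f\<close>. The fill-in shows that \<open>g \<cdot> f\<close> factors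
  through a zero object.\<close>

lemma triangle_cmp_zero:
  assumes t: "triangle T X Y Z f g h"
  shows "g \<cdot> f = zero_mor T X Z"
proof -
  note f = triangle_arr(1)[OF t] and g = triangle_arr(2)[OF t]
  obtain N where N: "zero_object T N" using ex_zero_object by blast
  have "triangle T X X N (idm T X) (zero_mor T X N) (zero_mor T N (Sh T X))"
    using arr_dom[OF f] N by (rule triangle_idm)
  then obtain c where c: "c \<in> mor T N Z" "c \<cdot> zero_mor T X N = g \<cdot> f"
    using triangle_mor[OF _ t, of X X N "idm T X" "zero_mor T X N" "zero_mor T N (Sh T X)" "idm T X" f]
      arr_idm[OF arr_dom[OF f]] f by (auto simp: arr_def)
  then have "arr T c N Z" using N g by (simp add: arr_def zero_object_def)
  then show ?thesis using c(2) cmp_zero arr_dom[OF f] by metis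
qed

lemma triangle_cmp_zero2: "triangle T X Y Z f g h \<Longrightarrow> h \<cdot> g = zero_mor T Y (Sh T X)"
  by (rule triangle_cmp_zero[OF triangle_rot])

lemma triangle_cmp_zero3:
  assumes "triangle T X Y Z f g h"
  shows "sh T f \<cdot> h = zero_mor T Z (Sh T Y)"
  using triangle_cmp_zero[OF triangle_rot[OF triangle_rot[OF assms]]]
    neg_cmp_zero_iff[OF triangle_arr(3)[OF assms] arr_sh[OF triangle_arr(1)[OF assms]]] by simp

text \<open>Exactness of Hom(W,-) at \<open>Y\<close>. The rotated identity triangle of
  \<open>W\<close>, which runs from \<open>W\<close> through zero to \<Sigma>W, is mapped to the
  rotation of the given one by \<open>y\<close> and zero. The fill-in goes from \<Sigma>W to
  \<Sigma>X, and fullness of the shift turns it into the lift. The rotations put the same sign on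
  both sides, and it cancels.\<close>

lemma triangle_lift:
  assumes t: "triangle T X Y Z f g h" and y: "arr T y W Y" and 0: "g \<cdot> y = zero_mor T W Z"
  obtains x where "arr T x W X" "f \<cdot> x = y"
proof -
  note f = triangle_arr(1)[OF t] and g = triangle_arr(2)[OF t]
  have W: "W \<in> obj T" and X: "X \<in> obj T" using y f by (simp_all add: arr_def)
  obtain N where N: "zero_object T N" using ex_zero_object by blast
  then have N': "N \<in> obj T" by (simp add: zero_object_def)
  let ?n = "\<lambda>U V k. inv\<^bsub>Hom T (Sh T U) (Sh T V)\<^esub> sh T k"
  have "triangle T W N (Sh T W) (zero_mor T W N) (zero_mor T N (Sh T W)) (?n W W (idm T W))"
    by (rule triangle_rot[OF triangle_idm[OF W N]])
  moreover have "arr T (zero_mor T N Z) N Z" using N' arr_cod[OF g] by (rule arr_zero)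
  moreover have "zero_mor T N Z \<cdot> zero_mor T W N = g \<cdot> y"
    using 0 cmp_zero[OF _ W] N' g arr_zero by (simp add: arr_def)
  ultimately obtain c where c: "c \<in> mor T (Sh T W) (Sh T X)"
      "sh T y \<cdot> ?n W W (idm T W) = ?n X Y f \<cdot> c"
    using triangle_mor[OF _ triangle_rot[OF t], of W N "Sh T W" "zero_mor T W N"
        "zero_mor T N (Sh T W)" "?n W W (idm T W)" y "zero_mor T N Z"] y by (auto simp: arr_def)
  have c': "arr T c (Sh T W) (Sh T X)" using c(1) W X by (simp add: arr_def Sh_closed)
  obtain x where x: "arr T x W X" "sh T x = c" using sh_full[OF W X c'] .
  interpret G: group "Hom T (Sh T W) (Sh T Y)"
    using y by (simp add: arr_def Hom_group Sh_closed)
  have "inv\<^bsub>Hom T (Sh T W) (Sh T Y)\<^esub> sh T y = inv\<^bsub>Hom T (Sh T W) (Sh T Y)\<^esub> (sh T (f \<cdot> x))"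
    using c(2) cmp_neg[OF arr_sh[OF arr_idm[OF W]] arr_sh[OF y]] neg_cmp[OF c' arr_sh[OF f]]
      sh_idm[OF W] id_right[OF arr_sh[OF y]] sh_cmp_arr[OF x(1) f] x(2) by simp
  then have "sh T y = sh T (f \<cdot> x)"
    using arr_mor[OF arr_sh[OF y]] arr_mor[OF arr_sh[OF arr_cmp[OF x(1) f]]] by (metis G.inv_inv)
  then have "y = f \<cdot> x" using y arr_cmp[OF x(1) f] by (blast intro: sh_inj)
  then show thesis using that x(1) by blast
qed

lemma triangle_lift2:
  assumes "triangle T X Y Z f g h" "arr T z W Z" "h \<cdot> z = zero_mor T W (Sh T X)"
  obtains y where "arr T y W Y" "g \<cdot> y = z"
  using triangle_lift[OF triangle_rot[OF assms(1)] assms(2,3)] .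

lemma triangle_lift3:
  assumes t: "triangle T X Y Z f g h" and w: "arr T w W (Sh T X)"
    and 0: "sh T f \<cdot> w = zero_mor T W (Sh T Y)"
  obtains z where "arr T z W Z" "h \<cdot> z = w"
proof -
  have "inv\<^bsub>Hom T (Sh T X) (Sh T Y)\<^esub> (sh T f) \<cdot> w = zero_mor T W (Sh T Y)"
    using 0 neg_cmp_zero_iff[OF w arr_sh[OF triangle_arr(1)[OF t]]] by simp
  then show thesis using triangle_lift2[OF triangle_rot[OF t] w] that by blast
qed

text \<open>The contravariant counterpart. Here the given triangle is mapped to the one with terms
  0, \<open>W\<close>, \<open>W\<close>, which is distinguished because its rotation is an identity
  triangle with zero object \<Sigma>N.\<close>

lemma triangle_extend:
  assumes t: "triangle T X Y Z f g h" and y: "arr T y Y W" and 0: "y \<cdot> f = zero_mor T X W"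
  obtains z where "arr T z Z W" "z \<cdot> g = y"
proof -
  note f = triangle_arr(1)[OF t] and g = triangle_arr(2)[OF t]
  have W: "W \<in> obj T" using y by (simp add: arr_def)
  obtain N where N: "zero_object T N" using ex_zero_object by blast
  have N': "N \<in> obj T" using N by (simp add: zero_object_def)
  have *: "triangle T N W W (zero_mor T N W) (idm T W) (zero_mor T W (Sh T N))"
  proof (subst triangle_rotate)
    show "candidate_triangle T N W W (zero_mor T N W) (idm T W) (zero_mor T W (Sh T N))"
      using W N' arr_zero[OF W Sh_closed[OF N']] arr_zero[OF N' W] arr_idm[OF W]
      by (simp add: candidate_triangle_def arr_def)
    have "inv\<^bsub>Hom T (Sh T N) (Sh T W)\<^esub> sh T (zero_mor T N W) = zero_mor T (Sh T N) (Sh T W)"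
      using sh_zero[OF N' W] Hom_group[OF Sh_closed[OF N'] Sh_closed[OF W]]
      by (simp add: group.is_monoid monoid.inv_one)
    then show "triangle T W W (Sh T N) (idm T W) (zero_mor T W (Sh T N))
        (inv\<^bsub>Hom T (Sh T N) (Sh T W)\<^esub> sh T (zero_mor T N W))"
      using triangle_idm[OF W zero_object_Sh[OF N]] by simp
  qed
  have "arr T (zero_mor T X N) X N" using arr_dom[OF f] N' by (rule arr_zero)
  moreover have "y \<cdot> f = zero_mor T N W \<cdot> zero_mor T X N"
    using 0 zero_cmp[OF calculation W] by simp
  ultimately obtain c where "c \<in> mor T Z W" "c \<cdot> g = idm T W \<cdot> y"
    using triangle_mor[OF t *, of "zero_mor T X N" y] y by (auto simp: arr_def)
  then show thesis
    using that[of c] id_left[OF y] g W by (simp add: arr_def)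
qed

section \<open>Coproducts and compact objects under the shift\<close>

lemma coproduct_Sh:
  assumes S: "is_coproduct T I X S \<iota>"
  shows "is_coproduct T I (\<lambda>i. Sh T (X i)) (Sh T S) (\<lambda>i. sh T (\<iota> i))"
proof (rule coproductI)
  note S_obj = coproduct_obj[OF S]
  show "Sh T S \<in> obj T" using S_obj by (rule Sh_closed)
  show "arr T (sh T (\<iota> i)) (Sh T (X i)) (Sh T S)" if "i \<in> I" for i
    using coproduct_arr[OF S that] by (rule arr_sh)
  have X: "X i \<in> obj T" if "i \<in> I" for i
    using coproduct_arr[OF S that] by (rule arr_dom)
  show "\<exists>g. arr T g (Sh T S) Z \<and> (\<forall>i\<in>I. g \<cdot> sh T (\<iota> i) = f i)"
    if Z: "Z \<in> obj T" and f: "\<And>i. i \<in> I \<Longrightarrow> arr T (f i) (Sh T (X i)) Z" for Z f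
  proof -
    \<comment> \<open>The test object is replaced by a suspension, because full faithfulness of the
      shift gives access only to maps between suspensions. The composite with \<open>a\<close> leads
      back to \<open>Z\<close>.\<close>
    obtain Z' a b where a: "arr T a (Sh T Z') Z" and b: "arr T b Z (Sh T Z')" and Z': "Z' \<in> obj T"
      and ab: "a \<cdot> b = idm T Z"
      using desuspension[OF Z] by metis
    have "\<exists>k. arr T k (X i) Z' \<and> sh T k = b \<cdot> f i" if i: "i \<in> I" for i
      using sh_full[OF X[OF i] Z' arr_cmp[OF f[OF i] b]] by blast
    then obtain k where k: "\<And>i. i \<in> I \<Longrightarrow> arr T (k i) (X i) Z'" "\<And>i. i \<in> I \<Longrightarrow> sh T (k i) = b \<cdot> f i"
      by metis
    obtain g where g: "arr T g S Z'" "\<And>i. i \<in> I \<Longrightarrow> g \<cdot> \<iota> i = k i"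
      using coproduct_desc[OF S Z' k(1)] by metis
    have "a \<cdot> sh T g \<cdot> sh T (\<iota> i) = f i" if i: "i \<in> I" for i
    proof -
      note \<iota> = coproduct_arr[OF S i]
      have "a \<cdot> sh T g \<cdot> sh T (\<iota> i) = a \<cdot> (b \<cdot> f i)"
        using assoc[OF arr_sh[OF \<iota>] arr_sh[OF g(1)] a] sh_cmp_arr[OF \<iota> g(1)] g(2)[OF i] k(2)[OF i] by simp
      then show ?thesis
        using assoc[OF f[OF i] b a] ab id_left[OF f[OF i]] by simp
    qed
    then show ?thesis using arr_cmp[OF arr_sh[OF g(1)] a] by blast
  qed
  show "g = g'" if g: "arr T g (Sh T S) Z" and g': "arr T g' (Sh T S) Z"
    and eq: "\<And>i. i \<in> I \<Longrightarrow> g \<cdot> sh T (\<iota> i) = g' \<cdot> sh T (\<iota> i)" for Z g g'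
  proof -
    obtain Z' a b where a: "arr T a (Sh T Z') Z" and b: "arr T b Z (Sh T Z')" and Z': "Z' \<in> obj T"
      and ab: "a \<cdot> b = idm T Z"
      using desuspension[OF arr_cod[OF g]] by metis
    obtain k where k: "arr T k S Z'" "sh T k = b \<cdot> g"
      using sh_full[OF S_obj Z' arr_cmp[OF g b]] .
    obtain k' where k': "arr T k' S Z'" "sh T k' = b \<cdot> g'"
      using sh_full[OF S_obj Z' arr_cmp[OF g' b]] .
    have "k = k'"
    proof (rule coproduct_ext[OF S k(1) k'(1)])
      fix i assume i: "i \<in> I"
      note \<iota> = coproduct_arr[OF S i]
      have "sh T (k \<cdot> \<iota> i) = sh T (k' \<cdot> \<iota> i)"
        using sh_cmp_arr[OF \<iota> k(1)] sh_cmp_arr[OF \<iota> k'(1)] k(2) k'(2) eq[OF i]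
          assoc[OF arr_sh[OF \<iota>] g b] assoc[OF arr_sh[OF \<iota>] g' b] by simp
      then show "k \<cdot> \<iota> i = k' \<cdot> \<iota> i"
        by (rule sh_inj[OF arr_cmp[OF \<iota> k(1)] arr_cmp[OF \<iota> k'(1)]])
    qed
    then have "a \<cdot> (b \<cdot> g) = a \<cdot> (b \<cdot> g')" using k(2) k'(2) by simp
    then show ?thesis
      using assoc[OF g b a] assoc[OF g' b a] ab id_left[OF g] id_left[OF g'] by simp
  qed
qed

text \<open>A map \<open>g\<close> out of \<open>D'\<close> equals
  \<open>(g \<cdot> a) \<cdot> b\<close>, so the induction can be run on maps out of
  \<open>D\<close>, for the property that the composite with \<open>b\<close> lies in
  \<open>H\<close>. In particular compactness is invariant under isomorphism.\<close>

lemma compact_retract: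
  assumes D: "compact_object V T D" and a: "arr T a D D'" and b: "arr T b D' D" and ab: "a \<cdot> b = idm T D'"
  shows "compact_object V T D'"
proof (rule compact_inductI)
  show D': "D' \<in> obj T" using a by (rule arr_cod)
  fix I X S \<iota> H g
  assume I: "small V I" and S: "is_coproduct T I X S \<iota>" and H0: "zero_mor T D' S \<in> H"
    and Hadd: "\<And>k l. \<lbrakk>k \<in> H; l \<in> H; arr T k D' S; arr T l D' S\<rbrakk> \<Longrightarrow> k \<otimes>\<^bsub>Hom T D' S\<^esub> l \<in> H"
    and H\<iota>: "\<And>i x. \<lbrakk>i \<in> I; arr T x D' (X i)\<rbrakk> \<Longrightarrow> \<iota> i \<cdot> x \<in> H" and g: "arr T g D' S"
  have "(g \<cdot> a) \<cdot> b \<in> H"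
  proof (rule compact_into_coproduct[OF D I S arr_cmp[OF a g], of "\<lambda>k. k \<cdot> b \<in> H"])
    show "zero_mor T D S \<cdot> b \<in> H" using H0 zero_cmp[OF b coproduct_obj[OF S]] by simp
    show "k \<otimes>\<^bsub>Hom T D S\<^esub> l \<cdot> b \<in> H"
      if "k \<cdot> b \<in> H" "l \<cdot> b \<in> H" and k: "arr T k D S" and l: "arr T l D S" for k l
      using Hadd[OF that(1,2) arr_cmp[OF b k] arr_cmp[OF b l]] add_cmp[OF b k l] by simp
    show "\<iota> i \<cdot> x \<cdot> b \<in> H" if i: "i \<in> I" and x: "arr T x D (X i)" for i x
      using H\<iota>[OF i arr_cmp[OF b x]] assoc[OF b x coproduct_arr[OF S i]] by simp
  qed
  then show "g \<in> H" using assoc[OF b a g] ab id_right[OF g] by simp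
qed

text \<open>The shift identifies maps from \<open>D\<close> to \<open>S\<close> with maps from
  \<Sigma>D to \<Sigma>S, and \<Sigma>S is the coproduct of the shifted summands. The property
  \<open>H\<close> is transported along this bijection.\<close>

lemma compact_desuspend:
  assumes D': "D \<in> obj T" and D: "compact_object V T (Sh T D)"
  shows "compact_object V T D"
proof (rule compact_inductI[OF D'])
  fix I X S \<iota> H g
  assume I: "small V I" and S: "is_coproduct T I X S \<iota>" and H0: "zero_mor T D S \<in> H"
    and Hadd: "\<And>k l. \<lbrakk>k \<in> H; l \<in> H; arr T k D S; arr T l D S\<rbrakk> \<Longrightarrow> k \<otimes>\<^bsub>Hom T D S\<^esub> l \<in> H"
    and H\<iota>: "\<And>i x. \<lbrakk>i \<in> I; arr T x D (X i)\<rbrakk> \<Longrightarrow> \<iota> i \<cdot> x \<in> H" and g: "arr T g D S"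
  let ?H = "\<lambda>k. \<exists>l\<in>H. arr T l D S \<and> k = sh T l"
  have "?H (sh T g)"
  proof (rule compact_into_coproduct[OF D I coproduct_Sh[OF S] arr_sh[OF g], of ?H])
    show "?H (zero_mor T (Sh T D) (Sh T S))"
      using H0 sh_zero[OF D' coproduct_obj[OF S]] arr_zero[OF D' coproduct_obj[OF S]] by metis
    show "?H (k \<otimes>\<^bsub>Hom T (Sh T D) (Sh T S)\<^esub> l)" if "?H k" "?H l" for k l
      using that Hadd sh_add arr_add by metis
    show "?H (sh T (\<iota> i) \<cdot> x)" if i: "i \<in> I" and x: "arr T x (Sh T D) (Sh T (X i))" for i x
    proof -
      note \<iota> = coproduct_arr[OF S i]
      obtain x' where x': "arr T x' D (X i)" "sh T x' = x"
        using sh_full[OF D' arr_dom[OF \<iota>] x] .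
      then show ?thesis
        using H\<iota>[OF i x'(1)] sh_cmp_arr[OF x'(1) \<iota>] arr_cmp[OF x'(1) \<iota>] by metis
    qed
  qed
  then show "g \<in> H" using sh_inj[OF g] by metis
qed

text \<open>Now the summands are arbitrary while the source is a suspension. They are replaced by
  suspensions of objects \<open>X' i\<close>, whose coproduct \<open>S'\<close> has to exist; this
  is where coproducts in \<open>T\<close> are called upon. Then \<Sigma>S' is identified with
  \<open>S\<close>, and the induction runs on maps from \<open>D\<close> to
  \<open>S'\<close>.\<close>

lemma compact_Sh:
  fixes V :: "'v itself"
  assumes C: "has_small_coproducts V T" and D: "compact_object V T D"
  shows "compact_object V T (Sh T D)"
proof (rule compact_inductI)
  have D': "D \<in> obj T" using D by (rule compact_obj)
  then show "Sh T D \<in> obj T" by (rule Sh_closed)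
  fix I :: "'v set" and X S \<iota> H g
  assume I: "small V I" and S: "is_coproduct T I X S \<iota>" and H0: "zero_mor T (Sh T D) S \<in> H"
    and Hadd: "\<And>k l. \<lbrakk>k \<in> H; l \<in> H; arr T k (Sh T D) S; arr T l (Sh T D) S\<rbrakk>
      \<Longrightarrow> k \<otimes>\<^bsub>Hom T (Sh T D) S\<^esub> l \<in> H"
    and H\<iota>: "\<And>i x. \<lbrakk>i \<in> I; arr T x (Sh T D) (X i)\<rbrakk> \<Longrightarrow> \<iota> i \<cdot> x \<in> H" and g: "arr T g (Sh T D) S"
  have X: "X i \<in> obj T" if "i \<in> I" for i
    using coproduct_arr[OF S that] by (rule arr_dom)
  have "\<exists>X' a. X' \<in> obj T \<and> iso_mor T (Sh T X') (X i) a" if "i \<in> I" for i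
    using Sh_ess_surj[OF X[OF that]] unfolding isomorphic_def by blast
  then obtain X' a where X': "\<And>i. i \<in> I \<Longrightarrow> X' i \<in> obj T"
      and a: "\<And>i. i \<in> I \<Longrightarrow> iso_mor T (Sh T (X' i)) (X i) (a i)"
    by metis
  have arra: "arr T (a i) (Sh T (X' i)) (X i)" if "i \<in> I" for i
    using a[OF that] X[OF that] Sh_closed[OF X'[OF that]] by (simp add: arr_def iso_mor_def)
  obtain S' \<iota>' where S': "is_coproduct T I X' S' \<iota>'"
    using small_coproduct[OF C I X'] .
  obtain b c where b: "arr T b (Sh T S') S" and c: "arr T c S (Sh T S')" and bc: "b \<cdot> c = idm T S"
    and b\<iota>: "\<And>i. i \<in> I \<Longrightarrow> b \<cdot> sh T (\<iota>' i) = \<iota> i \<cdot> a i"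
    using coproduct_iso[OF S coproduct_Sh[OF S'] a] by metis
  obtain g' where g': "arr T g' D S'" "sh T g' = c \<cdot> g"
    using sh_full[OF D' coproduct_obj[OF S'] arr_cmp[OF g c]] .
  have "b \<cdot> sh T g' \<in> H"
  proof (rule compact_into_coproduct[OF D I S' g'(1), of "\<lambda>k. b \<cdot> sh T k \<in> H"])
    show "b \<cdot> sh T (zero_mor T D S') \<in> H"
      using H0 sh_zero[OF D' coproduct_obj[OF S']] cmp_zero[OF b Sh_closed[OF D']] by simp
    show "b \<cdot> sh T (k \<otimes>\<^bsub>Hom T D S'\<^esub> l) \<in> H"
      if "b \<cdot> sh T k \<in> H" "b \<cdot> sh T l \<in> H" and k: "arr T k D S'" and l: "arr T l D S'" for k l
      using Hadd[OF that(1,2) arr_cmp[OF arr_sh[OF k] b] arr_cmp[OF arr_sh[OF l] b]]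
        sh_add[OF k l] cmp_add[OF arr_sh[OF k] arr_sh[OF l] b] by simp
    show "b \<cdot> sh T (\<iota>' i \<cdot> x) \<in> H" if i: "i \<in> I" and x: "arr T x D (X' i)" for i x
    proof -
      note \<iota>' = coproduct_arr[OF S' i] and \<iota> = coproduct_arr[OF S i]
      have "b \<cdot> sh T (\<iota>' i \<cdot> x) = (b \<cdot> sh T (\<iota>' i)) \<cdot> sh T x"
        using sh_cmp_arr[OF x \<iota>'] assoc[OF arr_sh[OF x] arr_sh[OF \<iota>'] b] by simp
      also have "\<dots> = \<iota> i \<cdot> (a i \<cdot> sh T x)"
        using b\<iota>[OF i] assoc[OF arr_sh[OF x] arra[OF i] \<iota>] by simp
      finally show ?thesis using H\<iota>[OF i arr_cmp[OF arr_sh[OF x] arra[OF i]]] by simp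
    qed
  qed
  then show "g \<in> H"
    using g'(2) assoc[OF g c b] bc id_left[OF g] by simp
qed

text \<open>This guarantees that the choice in \<open>shift_power\<close> is meaningful for negative
  exponents.\<close>

lemma isomorphic_Sh_power:
  assumes "X \<in> obj T"
  shows "\<exists>Y\<in>obj T. isomorphic T ((Sh T ^^ n) Y) X"
  using assms
proof (induction n arbitrary: X)
  case 0
  then have "isomorphic T X X"
    using arr_idm[OF 0] id_left[OF arr_idm[OF 0]] by (auto simp: isomorphic_def iso_mor_def arr_def)
  then show ?case using 0 by auto
next
  case (Suc n)
  obtain X' a b where a: "arr T a (Sh T X') X" and b: "arr T b X (Sh T X')" and X': "X' \<in> obj T"
    and ab: "a \<cdot> b = idm T X" and ba: "b \<cdot> a = idm T (Sh T X')"
    using desuspension[OF Suc.prems] by metis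
  obtain Y c d where Y: "Y \<in> obj T" and c: "arr T c ((Sh T ^^ n) Y) X'" and d: "arr T d X' ((Sh T ^^ n) Y)"
    and cd: "c \<cdot> d = idm T X'" and dc: "d \<cdot> c = idm T ((Sh T ^^ n) Y)"
    using Suc.IH[OF X'] unfolding isomorphic_def iso_mor_def arr_def by blast
  note c' = arr_sh[OF c] and d' = arr_sh[OF d]
  have "(a \<cdot> sh T c) \<cdot> (sh T d \<cdot> b) = a \<cdot> (sh T (c \<cdot> d) \<cdot> b)"
    using assoc[OF arr_cmp[OF b d'] c' a] assoc[OF b d' c'] sh_cmp_arr[OF d c] by simp
  also have "\<dots> = idm T X"
    by (simp add: cd sh_idm[OF X'] id_left[OF b] ab)
  finally have 1: "(a \<cdot> sh T c) \<cdot> (sh T d \<cdot> b) = idm T X" .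
  have "(sh T d \<cdot> b) \<cdot> (a \<cdot> sh T c) = sh T d \<cdot> ((b \<cdot> a) \<cdot> sh T c)"
    using assoc[OF arr_cmp[OF c' a] b d'] assoc[OF c' a b] by simp
  also have "\<dots> = idm T (Sh T ((Sh T ^^ n) Y))"
    by (simp add: ba id_left[OF c'] sh_cmp_arr[OF c d, symmetric] dc sh_idm[OF arr_dom[OF c]])
  finally have 2: "(sh T d \<cdot> b) \<cdot> (a \<cdot> sh T c) = idm T (Sh T ((Sh T ^^ n) Y))" .
  have "isomorphic T (Sh T ((Sh T ^^ n) Y)) X"
    using 1 2 arr_cmp[OF c' a] arr_cmp[OF b d'] unfolding isomorphic_def iso_mor_def arr_def by blast
  then show ?case using Y by auto
qed

lemma Sh_power_closed: "X \<in> obj T \<Longrightarrow> (Sh T ^^ n) X \<in> obj T"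
  by (induction n) (auto intro: Sh_closed)

text \<open>For negative exponents only a positive shift of the chosen object is known to be
  isomorphic to \<open>D\<close>. That shift is compact as a retract of \<open>D\<close>, and
  compactness descends along the shift one step at a time.\<close>

lemma compact_shift_power:
  assumes C: "has_small_coproducts V T" and D: "compact_object V T D"
  shows "compact_object V T (shift_power T k D)"
proof (cases "0 \<le> k")
  case True
  have "compact_object V T ((Sh T ^^ n) D)" for n
    by (induction n) (auto intro: D compact_Sh[OF C])
  then show ?thesis using True by (simp add: shift_power_def)
next
  case False
  let ?P = "\<lambda>Y. Y \<in> obj T \<and> isomorphic T ((Sh T ^^ nat (- k)) Y) D"
  have "?P (SOME Y. ?P Y)"
    by (rule someI_ex) (use isomorphic_Sh_power[OF compact_obj[OF D]] in blast)
  then have Y: "shift_power T k D \<in> obj T"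
      and iso: "isomorphic T ((Sh T ^^ nat (- k)) (shift_power T k D)) D"
    using False by (simp_all add: shift_power_def)
  obtain a b where "arr T a D ((Sh T ^^ nat (- k)) (shift_power T k D))"
      "arr T b ((Sh T ^^ nat (- k)) (shift_power T k D)) D"
      "a \<cdot> b = idm T ((Sh T ^^ nat (- k)) (shift_power T k D))"
    using iso unfolding isomorphic_def iso_mor_def arr_def by blast
  then have "compact_object V T ((Sh T ^^ nat (- k)) (shift_power T k D))"
    by (rule compact_retract[OF D])
  moreover have "compact_object V T Y" if "compact_object V T ((Sh T ^^ n) Y)" "Y \<in> obj T" for n Y
    using that by (induction n) (auto intro: compact_desuspend Sh_power_closed)
  ultimately show ?thesis using Y by blast
qed

end

section \<open>Modules\<close>

lemma module_group: "\<lbrakk>is_module V C M; X \<in> obj C\<rbrakk> \<Longrightarrow> comm_group (sec M X)"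
  and module_small: "\<lbrakk>is_module V C M; X \<in> obj C\<rbrakk> \<Longrightarrow> small V (carrier (sec M X))"
  and module_res: "\<lbrakk>is_module V C M; X \<in> obj C; Y \<in> obj C; f \<in> mor C X Y\<rbrakk>
    \<Longrightarrow> res M f \<in> hom (sec M Y) (sec M X)"
  and module_res_idm: "\<lbrakk>is_module V C M; X \<in> obj C; x \<in> carrier (sec M X)\<rbrakk> \<Longrightarrow> res M (idm C X) x = x"
  and module_res_cmp: "\<lbrakk>is_module V C M; X \<in> obj C; Y \<in> obj C; Z \<in> obj C; f \<in> mor C X Y; g \<in> mor C Y Z;
    x \<in> carrier (sec M Z)\<rbrakk> \<Longrightarrow> res M (g \<cdot>\<^bsub>C\<^esub> f) x = res M f (res M g x)"
  and module_res_add: "\<lbrakk>is_module V C M; X \<in> obj C; Y \<in> obj C; f \<in> mor C X Y; g \<in> mor C X Y;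
    x \<in> carrier (sec M Y)\<rbrakk>
    \<Longrightarrow> res M (f \<otimes>\<^bsub>Hom C X Y\<^esub> g) x = res M f x \<otimes>\<^bsub>sec M X\<^esub> res M g x"
  unfolding is_module_def by blast+

lemma module_hom_hom: "\<lbrakk>module_hom C M N \<phi>; X \<in> obj C\<rbrakk> \<Longrightarrow> \<phi> X \<in> hom (sec M X) (sec N X)"
  and module_hom_res: "\<lbrakk>module_hom C M N \<phi>; X \<in> obj C; Y \<in> obj C; f \<in> mor C X Y; y \<in> carrier (sec M Y)\<rbrakk>
    \<Longrightarrow> \<phi> X (res M f y) = res N f (\<phi> Y y)"
  unfolding module_hom_def by blast+

lemma module_homI:
  assumes "\<And>X. X \<in> obj C \<Longrightarrow> \<phi> X \<in> hom (sec M X) (sec N X)"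
    and "\<And>X Y f y. \<lbrakk>X \<in> obj C; Y \<in> obj C; f \<in> mor C X Y; y \<in> carrier (sec M Y)\<rbrakk>
      \<Longrightarrow> \<phi> X (res M f y) = res N f (\<phi> Y y)"
  shows "module_hom C M N \<phi>"
  using assms unfolding module_hom_def by blast

lemma module_hom_comp:
  assumes \<phi>: "module_hom C L M \<phi>" and \<psi>: "module_hom C M N \<psi>"
  shows "module_hom C L N (\<lambda>X x. \<psi> X (\<phi> X x))"
proof (rule module_homI)
  fix X Y f y assume X: "X \<in> obj C" and Y: "Y \<in> obj C" and f: "f \<in> mor C X Y" and y: "y \<in> carrier (sec L Y)"
  have "\<phi> Y y \<in> carrier (sec M Y)" using module_hom_hom[OF \<phi> Y] y by (auto simp: hom_def)
  then show "\<psi> X (\<phi> X (res L f y)) = res N f (\<psi> Y (\<phi> Y y))"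
    using module_hom_res[OF \<phi> X Y f y] module_hom_res[OF \<psi> X Y f] by simp
next
  fix X assume X: "X \<in> obj C"
  show "(\<lambda>x. \<psi> X (\<phi> X x)) \<in> hom (sec L X) (sec N X)"
    using module_hom_hom[OF \<phi> X] module_hom_hom[OF \<psi> X] by (simp add: hom_def Pi_iff)
qed

lemma module_hom_inverse:
  assumes M: "is_module V C M" and N: "is_module V C N" and \<phi>: "module_hom C M N \<phi>"
    and bij: "\<And>X. X \<in> obj C \<Longrightarrow> bij_betw (\<phi> X) (carrier (sec M X)) (carrier (sec N X))"
  shows "module_hom C N M (\<lambda>X. inv_into (carrier (sec M X)) (\<phi> X))"
proof (rule module_homI)
  fix X assume X: "X \<in> obj C"
  have "group (sec M X)" using module_group[OF M X] by (rule comm_group.axioms(2))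
  then show "inv_into (carrier (sec M X)) (\<phi> X) \<in> hom (sec N X) (sec M X)"
    using group.iso_set_sym module_hom_hom[OF \<phi> X] bij[OF X] unfolding iso_def by blast
next
  fix X Y f y assume X: "X \<in> obj C" and Y: "Y \<in> obj C" and f: "f \<in> mor C X Y" and y: "y \<in> carrier (sec N Y)"
  obtain x where x: "x \<in> carrier (sec M Y)" "y = \<phi> Y x"
    using y bij[OF Y] by (auto simp: bij_betw_def)
  have "res M f x \<in> carrier (sec M X)"
    using module_res[OF M X Y f] x(1) by (auto simp: hom_def)
  then show "inv_into (carrier (sec M X)) (\<phi> X) (res N f y) = res M f (inv_into (carrier (sec M Y)) (\<phi> Y) y)"
    using module_hom_res[OF \<phi> X Y f x(1), symmetric] x bij[OF X] bij[OF Y] by (simp add: bij_betw_def)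
qed

context preadditive_category
begin

text \<open>Injectivity is tested on modules with values in \<open>'v\<close>, whereas
  representables and their submodules take values in the type of morphisms. The structure is carried
  over along embeddings into \<open>'v\<close> chosen for each object.\<close>

lemma module_transport:
  fixes V :: "'v itself" and M :: "('o, 'm, 'g) presheaf"
  assumes M: "is_module V C M"
  obtains N :: "('o, 'm, 'v) presheaf" and e where "is_module V C N" "module_hom C M N e"
    "\<And>X. X \<in> obj C \<Longrightarrow> bij_betw (e X) (carrier (sec M X)) (carrier (sec N X))"
proof -
  have "\<exists>e :: 'g \<Rightarrow> 'v. X \<in> obj C \<longrightarrow> inj_on e (carrier (sec M X))" for X
    using module_small[OF M, of X] small_embedding by metis
  then obtain e :: "'o \<Rightarrow> 'g \<Rightarrow> 'v" where e: "\<And>X. X \<in> obj C \<Longrightarrow> inj_on (e X) (carrier (sec M X))"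
    by metis
  define d where "d X = inv_into (carrier (sec M X)) (e X)" for X
  have de: "d X (e X x) = x" if "X \<in> obj C" "x \<in> carrier (sec M X)" for X x
    using that e by (simp add: d_def)
  \<comment> \<open>The component \<open>res\<close> receives no objects; they are recovered from the disjointness of hom-sets.\<close>
  define ends where "ends f = (SOME (X, Y). X \<in> obj C \<and> Y \<in> obj C \<and> f \<in> mor C X Y)" for f
  have ends: "ends f = (X, Y)" if "X \<in> obj C" "Y \<in> obj C" "f \<in> mor C X Y" for f X Y
    unfolding ends_def by (rule some_equality) (use that Hom_disjoint in auto)
  define N where "N = \<lparr>
    sec = (\<lambda>X. \<lparr>carrier = e X ` carrier (sec M X),
      mult = (\<lambda>a b. e X (d X a \<otimes>\<^bsub>sec M X\<^esub> d X b)), one = e X \<one>\<^bsub>sec M X\<^esub>\<rparr>),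
    res = (\<lambda>f v. case ends f of (X, Y) \<Rightarrow> e X (res M f (d Y v)))\<rparr>"
  have carrier: "carrier (sec N X) = e X ` carrier (sec M X)" for X by (simp add: N_def)
  have mult: "e X x \<otimes>\<^bsub>sec N X\<^esub> e X y = e X (x \<otimes>\<^bsub>sec M X\<^esub> y)"
    if "X \<in> obj C" "x \<in> carrier (sec M X)" "y \<in> carrier (sec M X)" for X x y
    using that by (simp add: N_def de)
  have res: "res N f (e Y y) = e X (res M f y)"
    if "X \<in> obj C" "Y \<in> obj C" "f \<in> mor C X Y" "y \<in> carrier (sec M Y)" for f X Y y
    using that by (simp add: N_def ends[OF that(1-3)] de)
  have res_closed: "res M f y \<in> carrier (sec M X)"
    if "X \<in> obj C" "Y \<in> obj C" "f \<in> mor C X Y" "y \<in> carrier (sec M Y)" for f X Y y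
    using module_res[OF M that(1-3)] that(4) by (auto simp: hom_def)
  have e_hom: "e X \<in> hom (sec M X) (sec N X)" if "X \<in> obj C" for X
    using mult[OF that] by (simp add: hom_def carrier)
  have "is_module V C N"
    unfolding is_module_def
  proof (intro conjI ballI)
    fix X assume X: "X \<in> obj C"
    have "comm_group ((sec N X)\<lparr>carrier := e X ` carrier (sec M X), one := e X \<one>\<^bsub>sec M X\<^esub>\<rparr>)"
      by (rule comm_group.hom_imp_img_comm_group[OF module_group[OF M X] e_hom[OF X]])
    then show "comm_group (sec N X)" by (simp add: N_def)
    show "small V (carrier (sec N X))"
      unfolding carrier using module_small[OF M X] by (rule small_image)
    show "res N (idm C X) v = v" if "v \<in> carrier (sec N X)" for v
      using that res[OF X X idm_closed[OF X]] module_res_idm[OF M X] by (auto simp: carrier)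
    fix Y assume Y: "Y \<in> obj C"
    show "res N f \<in> hom (sec N Y) (sec N X)" if f: "f \<in> mor C X Y" for f
    proof (rule homI)
      show "res N f v \<in> carrier (sec N X)" if "v \<in> carrier (sec N Y)" for v
        using that res[OF X Y f] res_closed[OF X Y f] by (auto simp: carrier)
      show "res N f (v \<otimes>\<^bsub>sec N Y\<^esub> w) = res N f v \<otimes>\<^bsub>sec N X\<^esub> res N f w"
        if "v \<in> carrier (sec N Y)" "w \<in> carrier (sec N Y)" for v w
      proof -
        obtain x where x: "x \<in> carrier (sec M Y)" "v = e Y x" using \<open>v \<in> _\<close> by (auto simp: carrier)
        obtain y where y: "y \<in> carrier (sec M Y)" "w = e Y y" using \<open>w \<in> _\<close> by (auto simp: carrier)
        have xy: "x \<otimes>\<^bsub>sec M Y\<^esub> y \<in> carrier (sec M Y)"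
          using x(1) y(1) comm_groupE(1)[OF module_group[OF M Y]] by blast
        then show ?thesis
          using hom_mult[OF module_res[OF M X Y f] x(1) y(1)] x y
          by (simp add: mult[OF Y] res[OF X Y f] mult[OF X] res_closed[OF X Y f])
      qed
    qed
    show "res N (f \<otimes>\<^bsub>Hom C X Y\<^esub> g) v = res N f v \<otimes>\<^bsub>sec N X\<^esub> res N g v"
      if f: "f \<in> mor C X Y" and g: "g \<in> mor C X Y" and v: "v \<in> carrier (sec N Y)" for f g v
    proof -
      obtain x where x: "x \<in> carrier (sec M Y)" "v = e Y x" using v by (auto simp: carrier)
      have fg: "f \<otimes>\<^bsub>Hom C X Y\<^esub> g \<in> mor C X Y"
        using comm_groupE(1)[OF Hom_comm_group[OF X Y] f g] .
      show ?thesis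
        using module_res_add[OF M X Y f g x(1)] x
        by (simp add: res[OF X Y f] res[OF X Y g] res[OF X Y fg] mult[OF X] res_closed[OF X Y f] res_closed[OF X Y g])
    qed
    fix Z assume Z: "Z \<in> obj C"
    show "res N (g \<cdot> f) v = res N f (res N g v)"
      if f: "f \<in> mor C X Y" and g: "g \<in> mor C Y Z" and v: "v \<in> carrier (sec N Z)" for f g v
    proof -
      obtain x where x: "x \<in> carrier (sec M Z)" "v = e Z x" using v by (auto simp: carrier)
      show ?thesis
        using module_res_cmp[OF M X Y Z f g x(1)] x
        by (simp add: res[OF X Y f] res[OF Y Z g] res[OF X Z cmp_closed[OF X Y Z f g]] res_closed[OF Y Z g])
    qed
  qed
  moreover have "module_hom C M N e"
    by (rule module_homI) (simp_all add: e_hom res)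
  moreover have "bij_betw (e X) (carrier (sec M X)) (carrier (sec N X))" if "X \<in> obj C" for X
    using e[OF that] by (simp add: bij_betw_def carrier)
  ultimately show thesis by (rule that)
qed

text \<open>Both modules are replaced by copies with values in \<open>'v\<close>, the extension is
  taken there, and the result is pulled back along the isomorphism \<open>d\<close>.\<close>

lemma injective_module_extend:
  fixes V :: "'v itself"
  assumes E: "injective_module V C E" and M: "is_module V C M" and N: "is_module V C N"
    and \<phi>: "module_mono C M N \<phi>" and \<psi>: "module_hom C M E \<psi>"
  obtains \<theta> where "module_hom C N E \<theta>"
    "\<And>X x. \<lbrakk>X \<in> obj C; x \<in> carrier (sec M X)\<rbrakk> \<Longrightarrow> \<theta> X (\<phi> X x) = \<psi> X x"
proof -
  obtain M' :: "('o, 'm, 'v) presheaf" and e where M': "is_module V C M'" and e: "module_hom C M M' e"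
    and e_bij: "\<And>X. X \<in> obj C \<Longrightarrow> bij_betw (e X) (carrier (sec M X)) (carrier (sec M' X))"
    using module_transport[OF M] by metis
  obtain N' :: "('o, 'm, 'v) presheaf" and d where N': "is_module V C N'" and d: "module_hom C N N' d"
    and d_bij: "\<And>X. X \<in> obj C \<Longrightarrow> bij_betw (d X) (carrier (sec N X)) (carrier (sec N' X))"
    using module_transport[OF N] by metis
  let ?c = "\<lambda>X. inv_into (carrier (sec M X)) (e X)"
  have c: "module_hom C M' M ?c"
    by (rule module_hom_inverse[OF M M' e e_bij])
  have \<phi>': "module_hom C M N \<phi>" using \<phi> by (simp add: module_mono_def)
  let ?\<phi> = "\<lambda>X x. d X (\<phi> X (?c X x))"
  have "module_hom C M' N' ?\<phi>"
    using module_hom_comp[OF module_hom_comp[OF c \<phi>'] d] .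
  moreover have "inj_on (?\<phi> X) (carrier (sec M' X))" if X: "X \<in> obj C" for X
  proof -
    have "inj_on (\<phi> X) (carrier (sec M X))" using \<phi> X by (simp add: module_mono_def)
    moreover have "?c X ` carrier (sec M' X) = carrier (sec M X)"
      using e_bij[OF X] bij_betw_inv_into bij_betw_imp_surj_on by blast
    moreover have "inj_on (?c X) (carrier (sec M' X))"
      using e_bij[OF X] bij_betw_inv_into bij_betw_imp_inj_on by blast
    moreover have "\<phi> X ` carrier (sec M X) \<subseteq> carrier (sec N X)"
      using module_hom_hom[OF \<phi>' X] by (auto simp: hom_def)
    moreover have "inj_on (d X) (carrier (sec N X))"
      using d_bij[OF X] by (rule bij_betw_imp_inj_on)
    ultimately have "inj_on (d X \<circ> (\<phi> X \<circ> ?c X)) (carrier (sec M' X))"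
      by (intro comp_inj_on) (auto simp: image_comp[symmetric] intro: inj_on_subset)
    then show ?thesis by (simp add: comp_def)
  qed
  ultimately have "module_mono C M' N' ?\<phi>" by (simp add: module_mono_def)
  moreover have "module_hom C M' E (\<lambda>X x. \<psi> X (?c X x))"
    by (rule module_hom_comp[OF c \<psi>])
  ultimately obtain \<theta> where \<theta>: "module_hom C N' E \<theta>"
    "\<forall>X\<in>obj C. \<forall>x\<in>carrier (sec M' X). \<theta> X (?\<phi> X x) = \<psi> X (?c X x)"
    using E[unfolded injective_module_def, THEN conjunct2, THEN spec[of _ M'], THEN spec[of _ N'],
        THEN spec[of _ ?\<phi>], THEN spec[of _ "\<lambda>X x. \<psi> X (?c X x)"]] M' N' by blast
  show thesis
  proof
    show "module_hom C N E (\<lambda>X x. \<theta> X (d X x))" by (rule module_hom_comp[OF d \<theta>(1)])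
    fix X x assume X: "X \<in> obj C" and x: "x \<in> carrier (sec M X)"
    have "e X x \<in> carrier (sec M' X)" "?c X (e X x) = x"
      using e_bij[OF X] x by (auto simp: bij_betw_def)
    then show "\<theta> X (d X (\<phi> X x)) = \<psi> X x" using \<theta>(2) X by force
  qed
qed

end

section \<open>Restricted representable modules and their kernels\<close>

lemma compacts_simps [simp]:
  "obj (compacts V C) = {D. compact_object V C D}"
  "Hom (compacts V C) = Hom C" "idm (compacts V C) = idm C" "cmp (compacts V C) = cmp C"
  by (simp_all add: compacts_def)

context preadditive_category
begin

lemma preadditive_compacts: "preadditive_category (compacts V C)"
proof (rule preadditive_category.intro, unfold compacts_simps mem_Collect_eq)
  fix X Y assume "compact_object V C X" "compact_object V C Y"
  then show "comm_group (Hom C X Y)" by (intro Hom_comm_group compact_obj)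
next
  fix X Y X' Y' f
  assume "compact_object V C X" "compact_object V C Y" "compact_object V C X'" "compact_object V C Y'"
    "f \<in> mor C X Y" "f \<in> mor C X' Y'"
  then show "X = X' \<and> Y = Y'" by (intro Hom_disjoint compact_obj)
next
  fix X assume "compact_object V C X"
  then show "idm C X \<in> mor C X X" by (intro idm_closed compact_obj)
qed (rule cmp_closed cmp_assoc cmp_idm_right cmp_idm_left cmp_add_left cmp_add_right;
    (assumption | erule compact_obj))+

lemma yon_simps [simp]:
  "sec (yon C X) D = Hom C D X" "res (yon C X) f g = g \<cdot> f"
  by (simp_all add: yon_def)

lemma yon_is_module:
  assumes small: "\<And>D. D \<in> obj C \<Longrightarrow> small V (mor C D X)" and X: "X \<in> obj C"
  shows "is_module V (compacts V C) (yon C X)"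
proof -
  have "res (yon C X) f \<in> hom (Hom C E X) (Hom C D X)" if "arr C f D E" for f D E
    using cmp_hom_right[OF that X] by (simp add: yon_def)
  then show ?thesis
    unfolding is_module_def compacts_simps mem_Collect_eq yon_simps(1)
  proof (intro conjI ballI, unfold mem_Collect_eq)
    fix D E F f g x
    assume "compact_object V C D" "compact_object V C E" "compact_object V C F"
      "f \<in> mor C D E" "g \<in> mor C E F" "x \<in> mor C F X"
    then show "res (yon C X) (g \<cdot> f) x = res (yon C X) f (res (yon C X) g x)"
      using cmp_assoc[of D E F X f g x] X by (simp add: compact_obj)
  qed (auto simp: arr_def small Hom_comm_group X dest!: compact_obj
      intro: cmp_idm_right[OF _ X] cmp_add_right)
qed

lemma yon_mor_module_hom:
  assumes f: "arr C f X Y"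
  shows "module_hom (compacts V C) (yon C X) (yon C Y) (yon_mor C f)"
proof (rule module_homI)
  fix D assume "D \<in> obj (compacts V C)"
  then show "yon_mor C f D \<in> hom (sec (yon C X) D) (sec (yon C Y) D)"
    using cmp_hom_left[OF f] by (simp add: yon_mor_def compact_obj)
next
  fix D E k y
  assume "D \<in> obj (compacts V C)" "E \<in> obj (compacts V C)" "k \<in> mor (compacts V C) D E"
    "y \<in> carrier (sec (yon C X) E)"
  then have "arr C k D E" "arr C y E X" using f by (auto simp: arr_def compact_obj)
  then show "yon_mor C f D (res (yon C X) k y) = res (yon C Y) k (yon_mor C f E y)"
    using assoc[OF _ _ f] by (simp add: yon_mor_def)
qed

text \<open>The kernel of y\<open>f\<close> as a submodule of y\<open>X\<close>; only the carriers
  change, so operations and restriction maps are inherited. It is applied to the shift of the first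
  map of a triangle, where by exactness it is the image of the map that the connecting morphism
  induces.\<close>

definition ker_yon :: "'o \<Rightarrow> 'o \<Rightarrow> 'm \<Rightarrow> ('o, 'm, 'm) presheaf" where
  "ker_yon X Y f = (yon C X)\<lparr>sec := \<lambda>D. (Hom C D X)\<lparr>carrier := {x \<in> mor C D X. f \<cdot> x = zero_mor C D Y}\<rparr>\<rparr>"

lemma ker_yon_simps [simp]:
  "sec (ker_yon X Y f) D = (Hom C D X)\<lparr>carrier := {x \<in> mor C D X. f \<cdot> x = zero_mor C D Y}\<rparr>"
  "res (ker_yon X Y f) g x = x \<cdot> g"
  by (simp_all add: ker_yon_def yon_def)

lemma ker_yon_is_module:
  assumes small: "\<And>D. D \<in> obj C \<Longrightarrow> small V (mor C D X)" and f: "arr C f X Y"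
  shows "is_module V (compacts V C) (ker_yon X Y f)"
  unfolding is_module_def
proof (intro conjI ballI)
  have X: "X \<in> obj C" and Y: "Y \<in> obj C" using f by (simp_all add: arr_def)
  note M = yon_is_module[OF small X]
  fix D assume D: "D \<in> obj (compacts V C)"
  then have D': "D \<in> obj C" by (simp add: compact_obj)
  interpret Hom: comm_group "Hom C D X" using D' X by (rule Hom_comm_group)
  interpret group_hom "Hom C D X" "Hom C D Y" "\<lambda>x. f \<cdot> x"
    using cmp_hom_left[OF f D'] Hom_group[OF D' Y] by (simp add: group_hom_def group_hom_axioms_def Hom.is_group)
  have "subgroup {x \<in> mor C D X. f \<cdot> x = zero_mor C D Y} (Hom C D X)"
    using subgroup_kernel by (simp add: kernel_def)
  then have "group ((Hom C D X)\<lparr>carrier := {x \<in> mor C D X. f \<cdot> x = zero_mor C D Y}\<rparr>)"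
    by (rule subgroup.subgroup_is_group) (rule Hom.is_group)
  then show "comm_group (sec (ker_yon X Y f) D)"
    unfolding ker_yon_simps by (rule group.group_comm_groupI) (auto intro: Hom.m_comm)
  show "small V (carrier (sec (ker_yon X Y f) D))"
    using small[OF D'] by (rule small_subset) auto
  show "res (ker_yon X Y f) (idm (compacts V C) D) x = x" if "x \<in> carrier (sec (ker_yon X Y f) D)" for x
    using that D' X by (auto intro: cmp_idm_right)
  fix E assume E: "E \<in> obj (compacts V C)"
  then have E': "E \<in> obj C" by (simp add: compact_obj)
  show "res (ker_yon X Y f) g \<in> hom (sec (ker_yon X Y f) E) (sec (ker_yon X Y f) D)"
    if g: "g \<in> mor (compacts V C) D E" for g
  proof (rule homI)
    have g': "arr C g D E" using g D' E' by (simp add: arr_def)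
    fix x assume x: "x \<in> carrier (sec (ker_yon X Y f) E)"
    then have x': "arr C x E X" and 0: "f \<cdot> x = zero_mor C E Y" using E' X by (auto simp: arr_def)
    have "f \<cdot> (x \<cdot> g) = zero_mor C D Y"
      using assoc[OF g' x' f] 0 zero_cmp[OF g' Y] by simp
    then show "res (ker_yon X Y f) g x \<in> carrier (sec (ker_yon X Y f) D)"
      using arr_cmp[OF g' x'] by (simp add: arr_def)
    fix y assume y: "y \<in> carrier (sec (ker_yon X Y f) E)"
    then have y': "arr C y E X" using E' X by (auto simp: arr_def)
    show "res (ker_yon X Y f) g (x \<otimes>\<^bsub>sec (ker_yon X Y f) E\<^esub> y) =
        res (ker_yon X Y f) g x \<otimes>\<^bsub>sec (ker_yon X Y f) D\<^esub> res (ker_yon X Y f) g y"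
      using add_cmp[OF g' x' y'] by simp
  qed
  show "res (ker_yon X Y f) (g \<otimes>\<^bsub>Hom (compacts V C) D E\<^esub> k) x =
      res (ker_yon X Y f) g x \<otimes>\<^bsub>sec (ker_yon X Y f) D\<^esub> res (ker_yon X Y f) k x"
    if "g \<in> mor (compacts V C) D E" "k \<in> mor (compacts V C) D E" "x \<in> carrier (sec (ker_yon X Y f) E)" for g k x
    using that D' E' X by (auto intro: cmp_add_right)
  fix F assume F: "F \<in> obj (compacts V C)"
  then have F': "F \<in> obj C" by (simp add: compact_obj)
  show "res (ker_yon X Y f) (k \<cdot>\<^bsub>compacts V C\<^esub> g) x = res (ker_yon X Y f) g (res (ker_yon X Y f) k x)"
    if "g \<in> mor (compacts V C) D E" "k \<in> mor (compacts V C) E F" "x \<in> carrier (sec (ker_yon X Y f) F)" for g k x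
    using that cmp_assoc[OF D' E' F' X] by simp
qed

lemma ker_yon_inclusion: "module_mono (compacts V C) (ker_yon X Y f) (yon C X) (\<lambda>D x. x)"
  unfolding module_mono_def by (auto intro!: module_homI simp: hom_def)

end

section \<open>Phantom maps into pure injective objects\<close>

context preadditive_category
begin

lemma phantomI: "\<lbrakk>arr C f X Y; \<And>D g. \<lbrakk>compact_object V C D; arr C g D X\<rbrakk> \<Longrightarrow> f \<cdot> g = zero_mor C D Y\<rbrakk>
    \<Longrightarrow> phantom V C X Y f"
  by (simp add: phantom_def arr_def compact_obj)

lemma phantomD: "\<lbrakk>phantom V C X Y f; compact_object V C D; arr C g D X\<rbrakk> \<Longrightarrow> f \<cdot> g = zero_mor C D Y"
  by (simp add: phantom_def arr_def)

end

context triangulated_category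
begin

lemma pure_injective_obj: "pure_injective V T E \<Longrightarrow> E \<in> obj T"
  by (simp add: pure_injective_def)

text \<open>
  A factorization of a phantom map through the cone of \<open>p\<close>, the sum of all maps from \<open>\<H>\<close> to
  \<open>X\<close>, need not be phantom, but injectivity provides the correction.
\<close>

lemma phantom_factor:
  fixes V :: "'v itself"
  assumes V: "inaccessible V" and small: "\<And>X Y. \<lbrakk>X \<in> obj T; Y \<in> obj T\<rbrakk> \<Longrightarrow> small V (mor T X Y)"
    and cop: "has_small_coproducts V T" and E: "pure_injective V T E"
    and H: "small V \<H>" and compact: "\<And>D. D \<in> \<H> \<Longrightarrow> compact_object V T D"
    and X: "X \<in> obj T" and f: "phantom V T X E f"
  obtains Y u f' where "arr T u X Y" "phantom V T Y E f'" "f' \<cdot> u = f"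
    "\<And>D x. \<lbrakk>D \<in> \<H>; arr T x D X\<rbrakk> \<Longrightarrow> u \<cdot> x = zero_mor T D Y"
proof -
  note E_obj = pure_injective_obj[OF E]
  have f_arr: "arr T f X E" using f X E_obj by (simp add: phantom_def arr_def)
  \<comment> \<open>The summand belonging to a pair \<open>(D, x)\<close> is \<open>D\<close>, and
    \<open>p\<close> restricts to \<open>x\<close> on it. The set is small because
    \<open>\<H>\<close> and all hom-sets are.\<close>
  define K where "K = Sigma \<H> (\<lambda>D. mor T D X)"
  have K: "small V K"
    unfolding K_def using V H small[OF compact_obj[OF compact] X] by (rule small_Sigma)
  have K_compact: "compact_object V T (fst k)" if "k \<in> K" for k
    using that compact by (auto simp: K_def)
  have K_arr: "arr T (snd k) (fst k) X" if "k \<in> K" for k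
    using that K_compact[OF that] X by (auto simp: K_def arr_def compact_obj)
  obtain S \<iota> where S: "is_coproduct T K fst S \<iota>"
    using small_coproduct[OF cop K, of fst] compact_obj[OF K_compact] by metis
  note S_obj = coproduct_obj[OF S]
  obtain p where p: "arr T p S X" "\<And>k. k \<in> K \<Longrightarrow> p \<cdot> \<iota> k = snd k"
    using coproduct_desc[OF S X K_arr] by metis
  obtain Y u w where t: "triangle T S X Y p u w"
    using ex_triangle[OF S_obj X arr_mor[OF p(1)]] by blast
  note u = triangle_arr(2)[OF t] and w = triangle_arr(3)[OF t]
  note Y = arr_cod[OF u]
  have kill: "u \<cdot> x = zero_mor T D Y" if "D \<in> \<H>" "arr T x D X" for D x
  proof -
    have k: "(D, x) \<in> K" using that by (simp add: K_def arr_def)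
    note \<iota> = coproduct_arr[OF S k]
    have "u \<cdot> x = (u \<cdot> p) \<cdot> \<iota> (D, x)" using p(2)[OF k] assoc[OF \<iota> p(1) u] by simp
    then show ?thesis using triangle_cmp_zero[OF t] zero_cmp[OF \<iota> Y] by simp
  qed
  have "f \<cdot> p = zero_mor T S E"
  proof (rule coproduct_ext[OF S arr_cmp[OF p(1) f_arr] arr_zero[OF S_obj E_obj]])
    fix k assume k: "k \<in> K"
    note \<iota> = coproduct_arr[OF S k]
    show "f \<cdot> p \<cdot> \<iota> k = zero_mor T S E \<cdot> \<iota> k"
      using assoc[OF \<iota> p(1) f_arr] p(2)[OF k] phantomD[OF f K_compact[OF k] K_arr[OF k]]
        zero_cmp[OF \<iota> E_obj] by simp
  qed
  then obtain f1 where f1: "arr T f1 Y E" "f1 \<cdot> u = f"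
    using triangle_extend[OF t f_arr] by blast

  let ?C = "compacts V T"
  let ?M = "ker_yon (Sh T S) (Sh T X) (sh T p)"
  note Sh_S = Sh_closed[OF S_obj] and sh_p = arr_sh[OF p(1)]
  \<comment> \<open>A preimage under composition with \<open>w\<close>. It is evaluated only on maps
    killed by the shift of \<open>p\<close>, where exactness provides one; \<open>f1_eq\<close>
    shows that the choice does not affect the composite with \<open>f1\<close>.\<close>
  define lift where "lift D x = (SOME z. arr T z D Y \<and> w \<cdot> z = x)" for D x
  have lift: "arr T (lift D x) D Y" "w \<cdot> lift D x = x"
    if D: "compact_object V T D" and x: "x \<in> mor T D (Sh T S)" "sh T p \<cdot> x = zero_mor T D (Sh T X)" for D x
  proof -
    have "arr T x D (Sh T S)" using D x Sh_S by (simp add: arr_def compact_obj)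
    then have "\<exists>z. arr T z D Y \<and> w \<cdot> z = x" using triangle_lift3[OF t] x(2) by metis
    then have "arr T (lift D x) D Y \<and> w \<cdot> lift D x = x" unfolding lift_def by (rule someI_ex)
    then show "arr T (lift D x) D Y" "w \<cdot> lift D x = x" by blast+
  qed
  have f1_eq: "f1 \<cdot> z = f1 \<cdot> z'"
    if D: "compact_object V T D" and z: "arr T z D Y" and z': "arr T z' D Y" and eq: "w \<cdot> z = w \<cdot> z'" for D z z'
  proof -
    note d = arr_diff[OF z z']
    have "w \<cdot> diff D Y z z' = zero_mor T D (Sh T S)"
      using cmp_diff[OF z z' w] diff_eq_zero_iff[OF arr_cmp[OF z w] arr_cmp[OF z' w]] eq by simp
    then obtain y where y: "arr T y D X" "u \<cdot> y = diff D Y z z'"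
      using triangle_lift2[OF t d] by blast
    have "f1 \<cdot> diff D Y z z' = f \<cdot> y"
      using assoc[OF y(1) u f1(1)] f1(2) y(2) by simp
    also have "\<dots> = zero_mor T D E" by (rule phantomD[OF f D y(1)])
    finally show ?thesis
      using cmp_diff[OF z z' f1(1)] diff_eq_zero_iff[OF arr_cmp[OF z f1(1)] arr_cmp[OF z' f1(1)]] by simp
  qed
  define \<psi> where "\<psi> D x = f1 \<cdot> lift D x" for D x
  \<comment> \<open>This frees \<open>\<psi>\<close> from the choice: any preimage may be used.
    Additivity and naturality follow by adding or restricting preimages.\<close>
  have \<psi>: "\<psi> D (w \<cdot> z) = f1 \<cdot> z" if D: "compact_object V T D" and z: "arr T z D Y" for D z
  proof -
    have "sh T p \<cdot> (w \<cdot> z) = zero_mor T D (Sh T X)"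
      using assoc[OF z w sh_p] triangle_cmp_zero3[OF t] zero_cmp[OF z Sh_closed[OF X]] by simp
    then show ?thesis
      unfolding \<psi>_def using f1_eq[OF D _ z] lift[OF D arr_mor[OF arr_cmp[OF z w]]] by simp
  qed
  have "module_hom ?C ?M (yon T E) \<psi>"
  proof (rule module_homI, unfold compacts_simps mem_Collect_eq ker_yon_simps yon_simps)
    fix D assume D: "compact_object V T D"
    show "\<psi> D \<in> hom (Hom T D (Sh T S)\<lparr>carrier := {x \<in> mor T D (Sh T S). sh T p \<cdot> x = zero_mor T D (Sh T X)}\<rparr>)
        (Hom T D E)"
    proof (rule homI)
      fix x assume "x \<in> carrier (Hom T D (Sh T S)\<lparr>carrier := {x \<in> mor T D (Sh T S). sh T p \<cdot> x = zero_mor T D (Sh T X)}\<rparr>)"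
      then have x: "arr T (lift D x) D Y" "w \<cdot> lift D x = x" using lift[OF D] by simp_all
      show "\<psi> D x \<in> mor T D E"
        unfolding \<psi>_def using arr_cmp[OF x(1) f1(1)] by (rule arr_mor)
      fix y assume "y \<in> carrier (Hom T D (Sh T S)\<lparr>carrier := {x \<in> mor T D (Sh T S). sh T p \<cdot> x = zero_mor T D (Sh T X)}\<rparr>)"
      then have y: "arr T (lift D y) D Y" "w \<cdot> lift D y = y" using lift[OF D] by simp_all
      show "\<psi> D (x \<otimes>\<^bsub>Hom T D (Sh T S)\<lparr>carrier := {x \<in> mor T D (Sh T S). sh T p \<cdot> x = zero_mor T D (Sh T X)}\<rparr>\<^esub> y)
          = \<psi> D x \<otimes>\<^bsub>Hom T D E\<^esub> \<psi> D y"
        using \<psi>[OF D arr_add[OF x(1) y(1)]] cmp_add[OF x(1) y(1) w] cmp_add[OF x(1) y(1) f1(1)] x y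
        by (simp add: \<psi>_def)
    qed
  next
    fix D D' g y
    assume D: "compact_object V T D" and D': "compact_object V T D'" and g: "g \<in> mor T D D'"
      and y: "y \<in> carrier (Hom T D' (Sh T S)\<lparr>carrier := {x \<in> mor T D' (Sh T S). sh T p \<cdot> x = zero_mor T D' (Sh T X)}\<rparr>)"
    then have y': "arr T (lift D' y) D' Y" "w \<cdot> lift D' y = y" using lift[OF D'] by simp_all
    have g': "arr T g D D'" using g D D' by (simp add: arr_def compact_obj)
    show "\<psi> D (y \<cdot> g) = \<psi> D' y \<cdot> g"
      using \<psi>[OF D arr_cmp[OF g' y'(1)]] assoc[OF g' y'(1) w] assoc[OF g' y'(1) f1(1)] y'
      by (simp add: \<psi>_def)
  qed
  moreover have "injective_module V ?C (yon T E)" using E by (simp add: pure_injective_def)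
  ultimately obtain \<theta> where \<theta>: "module_hom ?C (yon T (Sh T S)) (yon T E) \<theta>"
    and \<theta>_eq: "\<And>D x. \<lbrakk>D \<in> obj ?C; x \<in> carrier (sec ?M D)\<rbrakk> \<Longrightarrow> \<theta> D x = \<psi> D x"
    using preadditive_category.injective_module_extend[OF preadditive_compacts
        _ ker_yon_is_module[OF small[OF _ Sh_S] sh_p] yon_is_module[OF small[OF _ Sh_S] Sh_S]
        ker_yon_inclusion] by metis
  have \<theta>_hom: "\<theta> D \<in> hom (Hom T D (Sh T S)) (Hom T D E)" if "compact_object V T D" for D
    using module_hom_hom[OF \<theta>, of D] that by simp
  have \<theta>_nat: "\<theta> D (y \<cdot> g) = \<theta> D' y \<cdot> g"
    if "compact_object V T D" "compact_object V T D'" "arr T g D D'" "arr T y D' (Sh T S)" for D D' g y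
    using module_hom_res[OF \<theta>, of D D' g y] that by (simp add: arr_def)

  \<comment> \<open>The shifted summands are compact, so \<open>\<theta>\<close> can be evaluated at
    the coproduct injections of \<Sigma>S. By the Yoneda lemma on each summand these values
    determine the candidate \<open>t\<close>.\<close>
  note Sh_compact = compact_Sh[OF cop K_compact]
  have \<theta>_arr: "arr T (\<theta> (Sh T (fst k)) (sh T (\<iota> k))) (Sh T (fst k)) E" if k: "k \<in> K" for k
  proof (rule arrI[OF compact_obj[OF Sh_compact[OF k]] E_obj])
    show "\<theta> (Sh T (fst k)) (sh T (\<iota> k)) \<in> mor T (Sh T (fst k)) E"
      using \<theta>_hom[OF Sh_compact[OF k]] arr_mor[OF coproduct_arr[OF coproduct_Sh[OF S] k]]
      by (auto simp: hom_def)
  qed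
  obtain t where t_arr: "arr T t (Sh T S) E"
    and t_eq: "\<And>k. k \<in> K \<Longrightarrow> t \<cdot> sh T (\<iota> k) = \<theta> (Sh T (fst k)) (sh T (\<iota> k))"
    using coproduct_desc[OF coproduct_Sh[OF S] E_obj \<theta>_arr] by metis
  \<comment> \<open>Both sides are additive in \<open>x\<close>, and on a map through one summand
    they agree by naturality of \<open>\<theta>\<close>.\<close>
  have t\<theta>: "t \<cdot> x = \<theta> D x" if D: "compact_object V T D" and x: "arr T x D (Sh T S)" for D x
  proof (rule compact_into_coproduct[OF D K coproduct_Sh[OF S] x, of "\<lambda>x. t \<cdot> x = \<theta> D x"])
    note D_obj = compact_obj[OF D]
    show "t \<cdot> zero_mor T D (Sh T S) = \<theta> D (zero_mor T D (Sh T S))"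
      using cmp_zero[OF t_arr D_obj]
        hom_one[OF \<theta>_hom[OF D] Hom_group[OF D_obj Sh_S] Hom_group[OF D_obj E_obj]] by simp
    show "t \<cdot> (a \<otimes>\<^bsub>Hom T D (Sh T S)\<^esub> b) = \<theta> D (a \<otimes>\<^bsub>Hom T D (Sh T S)\<^esub> b)"
      if "t \<cdot> a = \<theta> D a" "t \<cdot> b = \<theta> D b" "arr T a D (Sh T S)" "arr T b D (Sh T S)" for a b
      using cmp_add[OF that(3,4) t_arr] hom_mult[OF \<theta>_hom[OF D] arr_mor arr_mor, OF that(3,4)] that(1,2) by simp
    show "t \<cdot> (sh T (\<iota> k) \<cdot> y) = \<theta> D (sh T (\<iota> k) \<cdot> y)" if k: "k \<in> K" and y: "arr T y D (Sh T (fst k))" for k y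
    proof -
      note \<iota> = coproduct_arr[OF coproduct_Sh[OF S] k]
      show ?thesis
        using assoc[OF y \<iota> t_arr] t_eq[OF k] \<theta>_nat[OF D Sh_compact[OF k] y \<iota>] by simp
    qed
  qed

  \<comment> \<open>On a compact object \<open>t \<cdot> w\<close> acts as \<open>\<theta>\<close>
    after \<open>w\<close>, that is, as \<open>f1\<close>, so the difference is phantom. Since
    \<open>w \<cdot> u\<close> vanishes, the correction is invisible after composing with
    \<open>u\<close>.\<close>
  define f' where "f' = diff Y E f1 (t \<cdot> w)"
  note tw = arr_cmp[OF w t_arr]
  have f'_arr: "arr T f' Y E" unfolding f'_def by (rule arr_diff[OF f1(1) tw])
  have "phantom V T Y E f'"
  proof (rule phantomI[OF f'_arr])
    fix D z assume D: "compact_object V T D" and z: "arr T z D Y"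
    note wz = arr_cmp[OF z w]
    have "sh T p \<cdot> (w \<cdot> z) = zero_mor T D (Sh T X)"
      using assoc[OF z w sh_p] triangle_cmp_zero3[OF t] zero_cmp[OF z Sh_closed[OF X]] by simp
    then have "\<theta> D (w \<cdot> z) = f1 \<cdot> z"
      using \<theta>_eq[of D "w \<cdot> z"] D arr_mor[OF wz] \<psi>[OF D z] by simp
    then have "(t \<cdot> w) \<cdot> z = f1 \<cdot> z"
      using assoc[OF z w t_arr] t\<theta>[OF D wz] by simp
    then show "f' \<cdot> z = zero_mor T D E"
      unfolding f'_def using diff_cmp[OF z f1(1) tw] diff_eq_zero_iff[OF arr_cmp[OF z f1(1)] arr_cmp[OF z tw]] by simp
  qed
  moreover have "f' \<cdot> u = f"
  proof -
    have "(t \<cdot> w) \<cdot> u = zero_mor T X E"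
      using assoc[OF u w t_arr] triangle_cmp_zero2[OF t] cmp_zero[OF t_arr X] by simp
    then show ?thesis
      unfolding f'_def using diff_cmp[OF u f1(1) tw] f1(2) diff_zero[OF f_arr] by simp
  qed
  ultimately show thesis using that[OF u _ _ kill] by blast
qed

text \<open>A fixed desuspension \<open>W\<close> is iterated on all shifts of the generators. This
  yields closure by construction and avoids a comparison of the values of \<open>shift_power\<close>
  at negative exponents, which are chosen independently. Countably many objects arise from each
  generator, so the set remains small.\<close>

lemma desuspension_closed_generators:
  fixes V :: "'v itself"
  assumes V: "inaccessible V" and T: "compactly_generated V T"
  obtains \<H> where "small V \<H>" "\<And>D. D \<in> \<H> \<Longrightarrow> compact_object V T D"
    "\<And>D. D \<in> \<H> \<Longrightarrow> \<exists>D'\<in>\<H>. \<exists>a b. arr T a (Sh T D') D \<and> arr T b D (Sh T D') \<and> a \<cdot> b = idm T D"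
    "\<And>X. \<lbrakk>X \<in> obj T; \<And>D x. \<lbrakk>D \<in> \<H>; arr T x D X\<rbrakk> \<Longrightarrow> x = zero_mor T D X\<rbrakk> \<Longrightarrow> zero_object T X"
proof -
  have cop: "has_small_coproducts V T" using T by (simp add: compactly_generated_def)
  obtain \<G> where G: "small V \<G>" "\<And>G. G \<in> \<G> \<Longrightarrow> compact_object V T G"
    and gen: "\<And>X. X \<in> obj T \<Longrightarrow> zero_object T X \<longleftrightarrow>
      (\<forall>G\<in>\<G>. \<forall>i. mor T (shift_power T i G) X = {zero_mor T (shift_power T i G) X})"
    using T unfolding compactly_generated_def by blast
  have "\<forall>D. \<exists>D' a b. D \<in> obj T \<longrightarrow> D' \<in> obj T \<and> arr T a (Sh T D') D \<and> arr T b D (Sh T D') \<and>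
      a \<cdot> b = idm T D \<and> b \<cdot> a = idm T (Sh T D')"
    using desuspension by metis
  then obtain W a b where W: "\<And>D. D \<in> obj T \<Longrightarrow> W D \<in> obj T"
      "\<And>D. D \<in> obj T \<Longrightarrow> arr T (a D) (Sh T (W D)) D" "\<And>D. D \<in> obj T \<Longrightarrow> arr T (b D) D (Sh T (W D))"
      "\<And>D. D \<in> obj T \<Longrightarrow> a D \<cdot> b D = idm T D" "\<And>D. D \<in> obj T \<Longrightarrow> b D \<cdot> a D = idm T (Sh T (W D))"
    by metis
  define h where "h = (\<lambda>(G, i, n). (W ^^ n) (shift_power T i G))"
  define \<H> where "\<H> = h ` (\<G> \<times> (UNIV :: int set) \<times> (UNIV :: nat set))"
  show thesis
  proof
    show "small V \<H>"
      unfolding \<H>_def by (intro small_image small_Sigma V G small_countable) auto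
    have "compact_object V T ((W ^^ n) D)" if "compact_object V T D" for n D
    proof (induction n)
      case (Suc n)
      then have D: "compact_object V T ((W ^^ n) D)" by blast
      note D' = compact_obj[OF D]
      have "compact_object V T (Sh T (W ((W ^^ n) D)))"
        by (rule compact_retract[OF D W(3)[OF D'] W(2)[OF D'] W(5)[OF D']])
      then show ?case using compact_desuspend[OF W(1)[OF D']] by simp
    qed (simp add: that)
    then show compact: "compact_object V T D" if "D \<in> \<H>" for D
      using that compact_shift_power[OF cop G(2)] by (auto simp: \<H>_def h_def)
    show "\<exists>D'\<in>\<H>. \<exists>a b. arr T a (Sh T D') D \<and> arr T b D (Sh T D') \<and> a \<cdot> b = idm T D" if D: "D \<in> \<H>" for D
    proof -
      obtain G i n where "G \<in> \<G>" "D = (W ^^ n) (shift_power T i G)"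
        using D by (auto simp: \<H>_def h_def)
      then have "W D = h (G, i, Suc n)" "G \<in> \<G>" by (simp_all add: h_def)
      then have "W D \<in> \<H>" unfolding \<H>_def by blast
      then show ?thesis using W[OF compact_obj[OF compact[OF D]]] by blast
    qed
    show "zero_object T X"
      if X: "X \<in> obj T" and 0: "\<And>D x. \<lbrakk>D \<in> \<H>; arr T x D X\<rbrakk> \<Longrightarrow> x = zero_mor T D X" for X
      unfolding gen[OF X]
    proof (intro ballI allI)
      fix G i assume "G \<in> \<G>"
      \<comment> \<open>Zero iterations of \<open>W\<close> give the shifts of the generators
        themselves, so the enlarged set still detects zero objects.\<close>
      then have "h (G, i, 0) \<in> \<H>" unfolding \<H>_def by blast
      then have D: "shift_power T i G \<in> \<H>" by (simp add: h_def)
      show "mor T (shift_power T i G) X = {zero_mor T (shift_power T i G) X}"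
        using 0[OF D arrI[OF compact_obj[OF compact[OF D]] X]]
          arr_mor[OF arr_zero[OF compact_obj[OF compact[OF D]] X]] by blast
    qed
  qed
qed

lemma phantom_to_pure_injective:
  fixes V :: "'v itself"
  assumes V: "inaccessible V" and T: "compactly_generated V T" and E: "pure_injective V T E"
    and X: "X \<in> obj T" and f: "phantom V T X E f"
  shows "f = zero_mor T X E"
proof -
  have small: "small V (mor T X Y)" if "X \<in> obj T" "Y \<in> obj T" for X Y
    using T that by (simp add: compactly_generated_def)
  have cop: "has_small_coproducts V T" using T by (simp add: compactly_generated_def)
  note E_obj = pure_injective_obj[OF E]
  obtain \<H> where H: "small V \<H>" "\<And>D. D \<in> \<H> \<Longrightarrow> compact_object V T D"
    and desusp: "\<And>D. D \<in> \<H> \<Longrightarrow> \<exists>D'\<in>\<H>. \<exists>a b. arr T a (Sh T D') D \<and> arr T b D (Sh T D') \<and> a \<cdot> b = idm T D"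
    and gen: "\<And>X. \<lbrakk>X \<in> obj T; \<And>D x. \<lbrakk>D \<in> \<H>; arr T x D X\<rbrakk> \<Longrightarrow> x = zero_mor T D X\<rbrakk> \<Longrightarrow> zero_object T X"
    by (rule desuspension_closed_generators[OF V T]) blast

  \<comment> \<open>A state is an object with a phantom map to \<open>E\<close>; stage 0 is pinned
    to \<open>(X, f)\<close>. The transition maps occur only under an existential quantifier in
    \<open>?Q\<close> and are chosen once the sequence of states is known.\<close>
  let ?P = "\<lambda>n (Y, k). Y \<in> obj T \<and> phantom V T Y E k \<and> (n = 0 \<longrightarrow> (Y, k) = (X, f))"
  let ?Q = "\<lambda>(Y, k) (Y', k'). \<exists>u. arr T u Y Y' \<and> k' \<cdot> u = k \<and>
      (\<forall>D\<in>\<H>. \<forall>x. arr T x D Y \<longrightarrow> u \<cdot> x = zero_mor T D Y')"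
  have "\<exists>s. \<forall>n. ?P n (s n) \<and> ?Q (s n) (s (Suc n))"
  proof (rule dependent_nat_choice)
    show "\<exists>s. ?P 0 s" using X f by blast
    fix s and n :: nat assume "?P n s"
    then obtain Y k where s: "s = (Y, k)" and Y: "Y \<in> obj T" and k: "phantom V T Y E k"
      by (cases s) auto
    obtain Y' u k' where "arr T u Y Y'" "phantom V T Y' E k'" "k' \<cdot> u = k"
        "\<And>D x. \<lbrakk>D \<in> \<H>; arr T x D Y\<rbrakk> \<Longrightarrow> u \<cdot> x = zero_mor T D Y'"
      by (rule phantom_factor[OF V small cop E H Y k]) blast+
    then have "?P (Suc n) (Y', k') \<and> ?Q s (Y', k')"
      unfolding s by (auto dest: arr_cod)
    then show "\<exists>s'. ?P (Suc n) s' \<and> ?Q s s'" by blast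
  qed
  then obtain s where s: "\<forall>n. ?P n (s n) \<and> ?Q (s n) (s (Suc n))" by (rule exE)
  define Y where "Y n = fst (s n)" for n
  define k where "k n = snd (s n)" for n
  have Y: "Y n \<in> obj T" and k_phantom: "phantom V T (Y n) E (k n)" for n
    using s[THEN spec[of _ n], THEN conjunct1] by (simp_all add: Y_def k_def case_prod_beta)
  have 0: "Y 0 = X" "k 0 = f"
    using s[THEN spec[of _ 0], THEN conjunct1] by (simp_all add: Y_def k_def case_prod_beta)
  have "\<forall>n. \<exists>u. arr T u (Y n) (Y (Suc n)) \<and> k (Suc n) \<cdot> u = k n \<and>
      (\<forall>D\<in>\<H>. \<forall>x. arr T x D (Y n) \<longrightarrow> u \<cdot> x = zero_mor T D (Y (Suc n)))"
    using s by (simp add: Y_def k_def case_prod_beta)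
  then obtain u where u: "\<And>n. arr T (u n) (Y n) (Y (Suc n))" "\<And>n. k (Suc n) \<cdot> u n = k n"
      "\<And>n D x. \<lbrakk>D \<in> \<H>; arr T x D (Y n)\<rbrakk> \<Longrightarrow> u n \<cdot> x = zero_mor T D (Y (Suc n))"
    by metis
  have k: "arr T (k n) (Y n) E" for n
    using k_phantom[of n] Y E_obj by (simp add: phantom_def arr_def)

  obtain S \<iota> where S: "is_coproduct T (UNIV :: nat set) Y S \<iota>"
    using small_coproduct[OF cop small_countable[OF V], of "UNIV :: nat set" Y] Y by auto
  note S_obj = coproduct_obj[OF S] and \<iota> = coproduct_arr[OF S UNIV_I]
  obtain r where r: "arr T r S S" "\<And>n. r \<cdot> \<iota> n = \<iota> (Suc n) \<cdot> u n"
    using coproduct_desc[OF S S_obj, of "\<lambda>n. \<iota> (Suc n) \<cdot> u n"] arr_cmp[OF u(1) \<iota>] by auto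
  \<comment> \<open>By compactness it suffices to treat maps through one summand, and those are
    killed by the next transition map.\<close>
  have r_kill: "r \<cdot> y = zero_mor T D S" if D: "D \<in> \<H>" and y: "arr T y D S" for D y
  proof (rule compact_into_coproduct[OF H(2)[OF D] small_countable[OF V] S y])
    note D_obj = arr_dom[OF y]
    show "countable (UNIV :: nat set)" by simp
    show "r \<cdot> zero_mor T D S = zero_mor T D S" using cmp_zero[OF r(1) D_obj] .
    show "r \<cdot> (a \<otimes>\<^bsub>Hom T D S\<^esub> b) = zero_mor T D S"
      if "r \<cdot> a = zero_mor T D S" "r \<cdot> b = zero_mor T D S" "arr T a D S" "arr T b D S" for a b
      using cmp_add[OF that(3,4) r(1)] that(1,2) zero_add_zero[OF D_obj S_obj] by simp
    show "r \<cdot> (\<iota> n \<cdot> x) = zero_mor T D S" if x: "arr T x D (Y n)" for n x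
    proof -
      have "r \<cdot> (\<iota> n \<cdot> x) = \<iota> (Suc n) \<cdot> (u n \<cdot> x)"
        using assoc[OF x \<iota> r(1)] r(2) assoc[OF x u(1) \<iota>] by simp
      then show ?thesis using u(3)[OF D x] cmp_zero[OF \<iota> D_obj] by simp
    qed
  qed
  let ?d = "diff S S (idm T S) r"
  note id_S = arr_idm[OF S_obj]
  note d = arr_diff[OF id_S r(1)]
  have d_cmp: "?d \<cdot> y = y" if D: "D \<in> \<H>" and y: "arr T y D S" for D y
    using diff_cmp[OF y id_S r(1)] id_left[OF y] r_kill[OF D y] diff_zero[OF y] by simp
  obtain Z g h where t: "triangle T S S Z ?d g h"
    using ex_triangle[OF S_obj S_obj arr_mor[OF d]] by blast
  note g = triangle_arr(2)[OF t] and h = triangle_arr(3)[OF t]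
  note Z = arr_cod[OF g]
  have "zero_object T Z"
  proof (rule gen[OF Z])
    fix D z assume D: "D \<in> \<H>" and z: "arr T z D Z"
    \<comment> \<open>To show that \<open>h \<cdot> z\<close> vanishes, its source is turned into a
      suspension. The result is the shift of a map \<open>w\<close> from \<open>D'\<close> to
      \<open>S\<close> that \<open>?d\<close> both annihilates and fixes; the latter relies on
      \<open>D'\<close> lying in \<open>\<H>\<close>.\<close>
    obtain D' a b where D': "D' \<in> \<H>" and a: "arr T a (Sh T D') D" and b: "arr T b D (Sh T D')"
      and ab: "a \<cdot> b = idm T D"
      using desusp[OF D] by blast
    note D'_obj = compact_obj[OF H(2)[OF D']]
    note hz = arr_cmp[OF z h]
    obtain w where w: "arr T w D' S" "sh T w = (h \<cdot> z) \<cdot> a"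
      using sh_full[OF D'_obj S_obj arr_cmp[OF a hz]] .
    have "sh T (?d \<cdot> w) = sh T ?d \<cdot> ((h \<cdot> z) \<cdot> a)"
      using sh_cmp_arr[OF w(1) d] w(2) by simp
    also have "\<dots> = ((sh T ?d \<cdot> h) \<cdot> z) \<cdot> a"
      using assoc[OF a hz arr_sh[OF d]] assoc[OF z h arr_sh[OF d]] by simp
    also have "\<dots> = sh T (zero_mor T D' S)"
      using triangle_cmp_zero3[OF t] zero_cmp[OF z Sh_closed[OF S_obj]] zero_cmp[OF a Sh_closed[OF S_obj]]
        sh_zero[OF D'_obj S_obj] by simp
    finally have "?d \<cdot> w = zero_mor T D' S"
      by (rule sh_inj[OF arr_cmp[OF w(1) d] arr_zero[OF D'_obj S_obj]])
    then have "w = zero_mor T D' S" using d_cmp[OF D' w(1)] by simp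
    then have "(h \<cdot> z) \<cdot> a = zero_mor T (Sh T D') (Sh T S)" using w(2) sh_zero[OF D'_obj S_obj] by simp
    then have "h \<cdot> z = zero_mor T D (Sh T S)"
      using assoc[OF b a hz] ab id_right[OF hz] zero_cmp[OF b Sh_closed[OF S_obj]] by simp
    then obtain y where y: "arr T y D S" "g \<cdot> y = z"
      using triangle_lift2[OF t z] by blast
    \<comment> \<open>Since \<open>?d\<close> fixes \<open>y\<close>, the consecutive maps
      \<open>?d\<close> and \<open>g\<close> of the triangle can be brought together.\<close>
    then have "z = (g \<cdot> ?d) \<cdot> y"
      using assoc[OF y(1) d g] d_cmp[OF D y(1)] by simp
    then show "z = zero_mor T D Z"
      using triangle_cmp_zero[OF t] zero_cmp[OF y(1) Z] by simp
  qed
  note Z0 = this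

  obtain F where F: "arr T F S E" "\<And>n. F \<cdot> \<iota> n = k n"
    using coproduct_desc[OF S E_obj k] by auto
  \<comment> \<open>On each summand this is the factorization of \<open>k n\<close> through
    \<open>u n\<close>.\<close>
  have "F \<cdot> r = F"
  proof (rule coproduct_ext[OF S arr_cmp[OF r(1) F(1)] F(1)])
    fix n :: nat
    have "F \<cdot> r \<cdot> \<iota> n = (F \<cdot> \<iota> (Suc n)) \<cdot> u n"
      using assoc[OF \<iota> r(1) F(1)] r(2) assoc[OF u(1) \<iota> F(1)] by simp
    then show "F \<cdot> r \<cdot> \<iota> n = F \<cdot> \<iota> n" using F(2) u(2) by simp
  qed
  then have "F \<cdot> ?d = zero_mor T S E"
    using cmp_diff[OF id_S r(1) F(1)] id_right[OF F(1)] diff_eq_zero_iff[OF F(1) F(1)] by simp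
  then obtain z where z: "arr T z Z E" "z \<cdot> g = F"
    using triangle_extend[OF t F(1)] by blast
  have "F = zero_mor T S E"
    using z zero_object_from[OF Z0 z(1)] zero_cmp[OF g E_obj] by simp
  then show ?thesis
    using F(2)[of 0] 0 zero_cmp[OF \<iota>[of 0] E_obj] by simp
qed

end

section \<open>Pure triangles\<close>

context triangulated_category
begin

text \<open>The shift of \<open>x\<close> is annihilated by the shift of \<open>f\<close>, so it
  factors through \<open>h\<close>.\<close>

lemma monic_if_connecting_zero:
  assumes t: "triangle T X Y Z f g h" and 0: "h = zero_mor T Z (Sh T X)"
    and x: "arr T x W X" "f \<cdot> x = zero_mor T W Y"
  shows "x = zero_mor T W X"
proof -
  note f = triangle_arr(1)[OF t]
  note W = arr_dom[OF x(1)] and X = arr_dom[OF f]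
  have "sh T f \<cdot> sh T x = zero_mor T (Sh T W) (Sh T Y)"
    using sh_cmp_arr[OF x(1) f] x(2) sh_zero[OF W arr_cod[OF f]] by simp
  then obtain z where z: "arr T z (Sh T W) Z" "h \<cdot> z = sh T x"
    using triangle_lift3[OF t arr_sh[OF x(1)]] by blast
  then have "sh T x = sh T (zero_mor T W X)"
    using 0 zero_cmp[OF z(1) Sh_closed[OF X]] sh_zero[OF W X] by simp
  then show ?thesis by (rule sh_inj[OF x(1) arr_zero[OF W X]])
qed

text \<open>When \<open>h\<close> vanishes, the identity of \<open>Z\<close> lifts to a section
  \<open>s\<close> of \<open>g\<close>. The complement \<open>1 - s \<cdot> g\<close> is killed by
  \<open>g\<close> and factors as \<open>f \<cdot> r\<close>. The remaining biproduct equations for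
  \<open>r\<close> hold after composing with \<open>f\<close>, which is monic.\<close>

lemma split_triangle_iff:
  assumes t: "triangle T X Y Z f g h"
  shows "split_triangle T X Y Z f g h \<longleftrightarrow> h = zero_mor T Z (Sh T X)"
proof
  assume 0: "h = zero_mor T Z (Sh T X)"
  note f = triangle_arr(1)[OF t] and g = triangle_arr(2)[OF t]
  note X = arr_dom[OF f] and Y = arr_cod[OF f] and Z = arr_cod[OF g]
  note id_X = arr_idm[OF X] and id_Y = arr_idm[OF Y] and id_Z = arr_idm[OF Z]
  have "h \<cdot> idm T Z = zero_mor T Z (Sh T X)"
    using 0 id_right[OF triangle_arr(3)[OF t]] by simp
  then obtain s where s: "arr T s Z Y" "g \<cdot> s = idm T Z"
    using triangle_lift2[OF t id_Z] by blast
  note sg = arr_cmp[OF g s(1)]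
  let ?d = "diff Y Y (idm T Y) (s \<cdot> g)"
  have "g \<cdot> ?d = zero_mor T Y Z"
    using cmp_diff[OF id_Y sg g] id_right[OF g] assoc[OF g s(1) g] s(2) id_left[OF g]
      diff_eq_zero_iff[OF g g] by simp
  then obtain r where r: "arr T r Y X" "f \<cdot> r = ?d"
    using triangle_lift[OF t arr_diff[OF id_Y sg]] by blast
  note rf = arr_cmp[OF f r(1)]
  have gf: "g \<cdot> f = zero_mor T X Z" by (rule triangle_cmp_zero[OF t])
  have "f \<cdot> (r \<cdot> f) = f"
    using assoc[OF f r(1) f] r(2) diff_cmp[OF f id_Y sg] id_left[OF f] assoc[OF f g s(1)] gf
      cmp_zero[OF s(1) X] diff_zero[OF f] by simp
  then have "f \<cdot> diff X X (r \<cdot> f) (idm T X) = zero_mor T X Y"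
    using cmp_diff[OF rf id_X f] id_right[OF f] diff_eq_zero_iff[OF f f] by simp
  then have rf_id: "r \<cdot> f = idm T X"
    using monic_if_connecting_zero[OF t 0 arr_diff[OF rf id_X]] diff_eq_zero_iff[OF rf id_X] by simp
  have "f \<cdot> (r \<cdot> s) = zero_mor T Z Y"
    using assoc[OF s(1) r(1) f] r(2) diff_cmp[OF s(1) id_Y sg] id_left[OF s(1)] assoc[OF s(1) g s(1)]
      s(2) id_right[OF s(1)] diff_eq_zero_iff[OF s(1) s(1)] by simp
  then have rs: "r \<cdot> s = zero_mor T Z X"
    using monic_if_connecting_zero[OF t 0 arr_cmp[OF s(1) r(1)]] by simp
  have "f \<cdot> r \<otimes>\<^bsub>Hom T Y Y\<^esub> (s \<cdot> g) = idm T Y"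
  proof -
    interpret group "Hom T Y Y" using Y Y by (rule Hom_group)
    show ?thesis
      using r(2) arr_mor[OF id_Y] arr_mor[OF sg] by (simp add: m_assoc)
  qed
  then have "biproduct T X Z Y f s r g"
    using f g s r(1) gf rf_id rs X Y Z by (simp add: biproduct_def arr_def)
  then show "split_triangle T X Y Z f g h"
    using t 0 unfolding split_triangle_def by blast
qed (simp add: split_triangle_def)

text \<open>By exactness, \<open>h\<close> is phantom exactly if composition with \<open>g\<close>
  is surjective on maps from compact objects. Injectivity for \<open>f\<close> at \<open>D\<close>
  then follows from phantomness at \<Sigma>D, which is compact because \<open>T\<close> has
  coproducts.\<close>

lemma pure_triangle_iff_phantom:
  assumes cop: "has_small_coproducts V T" and t: "triangle T X Y Z f g h"
  shows "pure_triangle V T X Y Z f g h \<longleftrightarrow> phantom V T Z (Sh T X) h"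
proof
  note f = triangle_arr(1)[OF t] and g = triangle_arr(2)[OF t] and h = triangle_arr(3)[OF t]
  note X = arr_dom[OF f] and Y = arr_cod[OF f] and Z = arr_cod[OF g]
  {
    assume p: "pure_triangle V T X Y Z f g h"
    show "phantom V T Z (Sh T X) h"
    proof (rule phantomI[OF h])
      fix D z assume D: "compact_object V T D" and z: "arr T z D Z"
      have "yon_mor T g D ` mor T D Y = mor T D Z"
        using p D by (simp add: pure_triangle_def short_exact_def)
      then have "z \<in> yon_mor T g D ` mor T D Y" using arr_mor[OF z] by simp
      then obtain y where "z = yon_mor T g D y" "y \<in> mor T D Y" by (rule imageE)
      then have y: "arr T y D Y" "z = g \<cdot> y"
        using Y by (simp_all add: arr_def yon_mor_def compact_obj[OF D])
      then show "h \<cdot> z = zero_mor T D (Sh T X)"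
        using assoc[OF y(1) g h] triangle_cmp_zero2[OF t] zero_cmp[OF y(1) Sh_closed[OF X]] by simp
    qed
  next
    assume p: "phantom V T Z (Sh T X) h"
    show "pure_triangle V T X Y Z f g h"
      unfolding pure_triangle_def short_exact_def compacts_simps yon_simps
    proof (intro conjI ballI t yon_mor_module_hom f g, unfold mem_Collect_eq)
      fix D assume D: "compact_object V T D"
      note D_obj = compact_obj[OF D]
      interpret group_hom "Hom T D X" "Hom T D Y" "yon_mor T f D"
        using cmp_hom_left[OF f D_obj] Hom_group[OF D_obj X] Hom_group[OF D_obj Y]
        by (simp add: group_hom_def group_hom_axioms_def yon_mor_def)
      show "inj_on (yon_mor T f D) (mor T D X)"
        unfolding inj_on_one_iff
      proof (intro allI impI)
        fix x assume "x \<in> mor T D X" and 0: "yon_mor T f D x = zero_mor T D Y"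
        then have x: "arr T x D X" using D_obj X by (simp add: arr_def)
        have "sh T f \<cdot> sh T x = zero_mor T (Sh T D) (Sh T Y)"
          using sh_cmp_arr[OF x f] 0 sh_zero[OF D_obj Y] by (simp add: yon_mor_def)
        then obtain z where z: "arr T z (Sh T D) Z" "h \<cdot> z = sh T x"
          using triangle_lift3[OF t arr_sh[OF x]] by blast
        then have "sh T x = sh T (zero_mor T D X)"
          using phantomD[OF p compact_Sh[OF cop D] z(1)] sh_zero[OF D_obj X] by simp
        then show "x = zero_mor T D X" by (rule sh_inj[OF x arr_zero[OF D_obj X]])
      qed
      show "yon_mor T f D ` mor T D X = kernel (Hom T D Y) (Hom T D Z) (yon_mor T g D)"
      proof
        show "yon_mor T f D ` mor T D X \<subseteq> kernel (Hom T D Y) (Hom T D Z) (yon_mor T g D)"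
        proof
          fix y assume "y \<in> yon_mor T f D ` mor T D X"
          then obtain x where x: "arr T x D X" "y = f \<cdot> x"
            using D_obj X by (auto simp: arr_def yon_mor_def)
          then show "y \<in> kernel (Hom T D Y) (Hom T D Z) (yon_mor T g D)"
            using arr_mor[OF arr_cmp[OF x(1) f]] assoc[OF x(1) f g] triangle_cmp_zero[OF t] zero_cmp[OF x(1) Z]
            by (simp add: kernel_def yon_mor_def)
        qed
        show "kernel (Hom T D Y) (Hom T D Z) (yon_mor T g D) \<subseteq> yon_mor T f D ` mor T D X"
        proof
          fix y assume "y \<in> kernel (Hom T D Y) (Hom T D Z) (yon_mor T g D)"
          then have "arr T y D Y" "g \<cdot> y = zero_mor T D Z"
            using D_obj Y by (simp_all add: arr_def kernel_def yon_mor_def)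
          then obtain x where "arr T x D X" "f \<cdot> x = y" by (rule triangle_lift[OF t])
          then show "y \<in> yon_mor T f D ` mor T D X"
            using arr_mor by (auto simp: yon_mor_def)
        qed
      qed
      show "yon_mor T g D ` mor T D Y = mor T D Z"
      proof
        show "yon_mor T g D ` mor T D Y \<subseteq> mor T D Z"
          using cmp_hom_left[OF g D_obj] by (auto simp: yon_mor_def hom_def)
        show "mor T D Z \<subseteq> yon_mor T g D ` mor T D Y"
        proof
          fix z assume "z \<in> mor T D Z"
          then have z: "arr T z D Z" using D_obj Z by (simp add: arr_def)
          obtain y where "arr T y D Y" "g \<cdot> y = z"
            using triangle_lift2[OF t z phantomD[OF p D z]] .
          then show "z \<in> yon_mor T g D ` mor T D Y"
            using arr_mor by (auto simp: yon_mor_def)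
        qed
      qed
    qed
  }
qed

lemma pure_monoD:
  assumes "pure_mono V T X Y i"
  shows "arr T i X Y"
    and "\<lbrakk>compact_object V T D; arr T g D X; i \<cdot> g = zero_mor T D Y\<rbrakk> \<Longrightarrow> g = zero_mor T D X"
proof -
  obtain Z k h where p: "pure_triangle V T X Y Z i k h"
    using assms unfolding pure_mono_def by blast
  then show i: "arr T i X Y"
    by (intro triangle_arr(1)[of X Y Z i k h]) (simp add: pure_triangle_def)
  assume D: "compact_object V T D" and g: "arr T g D X" and 0: "i \<cdot> g = zero_mor T D Y"
  have "inj_on (yon_mor T i D) (mor T D X)"
    using p D by (simp add: pure_triangle_def short_exact_def)
  moreover have "yon_mor T i D g = yon_mor T i D (zero_mor T D X)"
    using 0 cmp_zero[OF i compact_obj[OF D]] by (simp add: yon_mor_def)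
  ultimately show "g = zero_mor T D X"
    using arr_mor[OF g] arr_mor[OF arr_zero[OF compact_obj[OF D] arr_cod[OF g]]]
    by (simp add: inj_on_eq_iff)
qed

end


section \<open>Duality triples\<close>

text \<open>The induced connecting map is the shift of \<open>Fm F h\<close> preceded by an
  isomorphism, and the shift is faithful.\<close>

lemma (in exact_contra_functor) induced_connecting_eq_zero_iff:
  assumes T: "triangulated_category T" and U: "triangulated_category U"
    and h: "arr T h Z (Sh T X)" and X: "X \<in> obj T"
  shows "induced_connecting U F X h = zero_mor U (Fo F X) (Sh U (Fo F Z)) \<longleftrightarrow>
    Fm F h = zero_mor U (Fo F (Sh T X)) (Fo F Z)"
proof
  interpret T: triangulated_category T by (rule T)
  interpret U: triangulated_category U by (rule U)
  note FX = Fo_closed[OF X] and FSX = Fo_closed[OF T.Sh_closed[OF X]] and FZ = Fo_closed[OF T.arr_dom[OF h]]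
  have Fh: "arr U (Fm F h) (Fo F (Sh T X)) (Fo F Z)"
    using Fm_hom[OF T.arr_dom[OF h] T.Sh_closed[OF X]] T.arr_mor[OF h] FSX FZ by (auto simp: arr_def hom_def)
  obtain b where s: "arr U (Fs F X) (Fo F X) (Sh U (Fo F (Sh T X)))"
    and b: "arr U b (Sh U (Fo F (Sh T X))) (Fo F X)" and sb: "Fs F X \<cdot>\<^bsub>U\<^esub> b = idm U (Sh U (Fo F (Sh T X)))"
    using Fs_iso[OF X] FX U.Sh_closed[OF FSX] unfolding iso_mor_def arr_def by blast
  note shFh = U.arr_sh[OF Fh]
  {
    assume "induced_connecting U F X h = zero_mor U (Fo F X) (Sh U (Fo F Z))"
    then have "(sh U (Fm F h) \<cdot>\<^bsub>U\<^esub> Fs F X) \<cdot>\<^bsub>U\<^esub> b = zero_mor U (Fo F X) (Sh U (Fo F Z)) \<cdot>\<^bsub>U\<^esub> b"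
      by (simp add: induced_connecting_def)
    then have "sh U (Fm F h) = zero_mor U (Sh U (Fo F (Sh T X))) (Sh U (Fo F Z))"
      using U.assoc[OF b s shFh] sb U.id_right[OF shFh] U.zero_cmp[OF b U.Sh_closed[OF FZ]] by simp
    then show "Fm F h = zero_mor U (Fo F (Sh T X)) (Fo F Z)"
      using U.sh_zero[OF FSX FZ] by (intro U.sh_inj[OF Fh U.arr_zero[OF FSX FZ]]) simp
  next
    assume "Fm F h = zero_mor U (Fo F (Sh T X)) (Fo F Z)"
    then show "induced_connecting U F X h = zero_mor U (Fo F X) (Sh U (Fo F Z))"
      using U.sh_zero[OF FSX FZ] U.zero_cmp[OF s U.Sh_closed[OF FZ]] by (simp add: induced_connecting_def)
  }
qed

lemma phantom_iff_dual_zero: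
  fixes V :: "'v itself"
  assumes V: "inaccessible V" and dual: "duality_triple V T U P R" and f: "arr T f X Y"
  shows "phantom V T X Y f \<longleftrightarrow> Fm P f = zero_mor U (Fo P Y) (Fo P X)"
proof -
  have T: "compactly_generated V T" and U: "compactly_generated V U"
    using dual by (simp_all add: duality_triple_def)
  interpret T: triangulated_category T using T by (simp add: compactly_generated_def)
  interpret U: triangulated_category U using U by (simp add: compactly_generated_def)
  interpret P: exact_contra_functor T U P using dual by (simp add: duality_triple_def)
  interpret R: exact_contra_functor U T R using dual by (simp add: duality_triple_def)
  obtain i j where "half_duality V T U P R i j" and "half_duality V U T R P j i"
    using dual unfolding duality_triple_def by blast
  \<comment> \<open>The conditions \<open>pinj\<close> and \<open>j_mono\<close> come from the half
    of the duality on objects of \<open>U\<close>, the others from the half on objects of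
    \<open>T\<close>.\<close>
  then have pinj: "\<And>W. W \<in> obj U \<Longrightarrow> pure_injective V T (Fo R W)"
    and i_mono: "\<And>X. X \<in> obj T \<Longrightarrow> pure_mono V T X (Fo R (Fo P X)) (i X)"
    and j_mono: "\<And>W. W \<in> obj U \<Longrightarrow> pure_mono V U W (Fo P (Fo R W)) (j W)"
    and i_nat: "\<And>X Y f. \<lbrakk>X \<in> obj T; Y \<in> obj T; f \<in> mor T X Y\<rbrakk> \<Longrightarrow> Fm R (Fm P f) \<cdot>\<^bsub>T\<^esub> i X = i Y \<cdot>\<^bsub>T\<^esub> f"
    and ij: "\<And>X. X \<in> obj T \<Longrightarrow> Fm P (i X) \<cdot>\<^bsub>U\<^esub> j (Fo P X) = idm U (Fo P X)"
    unfolding half_duality_def by blast+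
  note X = T.arr_dom[OF f] and Y = T.arr_cod[OF f]
  note PX = P.Fo_closed[OF X] and PY = P.Fo_closed[OF Y]
  note RPX = R.Fo_closed[OF PX] and RPY = R.Fo_closed[OF PY]
  note iX = T.pure_monoD(1)[OF i_mono[OF X]] and iY = T.pure_monoD(1)[OF i_mono[OF Y]]
  have P_arr: "arr U (Fm P g) (Fo P W') (Fo P W)" if "arr T g W W'" for g W W'
    using that P.Fm_hom[of W W'] P.Fo_closed by (auto simp: arr_def hom_def)
  note Pf = P_arr[OF f] and PiY = P_arr[OF iY]
  note jPY = U.pure_monoD(1)[OF j_mono[OF PY]]
  show ?thesis
  proof
    assume ph: "phantom V T X Y f"
    have "phantom V T X (Fo R (Fo P Y)) (i Y \<cdot>\<^bsub>T\<^esub> f)"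
    proof (rule T.phantomI[OF T.arr_cmp[OF f iY]])
      fix D g assume D: "compact_object V T D" and g: "arr T g D X"
      show "i Y \<cdot>\<^bsub>T\<^esub> f \<cdot>\<^bsub>T\<^esub> g = zero_mor T D (Fo R (Fo P Y))"
        using T.assoc[OF g f iY] T.phantomD[OF ph D g] T.cmp_zero[OF iY T.compact_obj[OF D]] by simp
    qed
    then have "i Y \<cdot>\<^bsub>T\<^esub> f = zero_mor T X (Fo R (Fo P Y))"
      by (rule T.phantom_to_pure_injective[OF V T pinj[OF PY] X])
    then have "Fm P f \<cdot>\<^bsub>U\<^esub> Fm P (i Y) = zero_mor U (Fo P (Fo R (Fo P Y))) (Fo P X)"
      using P.Fm_cmp[OF X Y RPY T.arr_mor[OF f] T.arr_mor[OF iY]]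
        hom_one[OF P.Fm_hom[OF X RPY] T.Hom_group[OF X RPY] U.Hom_group[OF P.Fo_closed[OF RPY] PX]] by simp
    then have "(Fm P f \<cdot>\<^bsub>U\<^esub> Fm P (i Y)) \<cdot>\<^bsub>U\<^esub> j (Fo P Y) = zero_mor U (Fo P Y) (Fo P X)"
      using U.zero_cmp[OF jPY PX] by simp
    then show "Fm P f = zero_mor U (Fo P Y) (Fo P X)"
      using U.assoc[OF jPY PiY Pf] ij[OF Y] U.id_right[OF Pf] by simp
  next
    assume 0: "Fm P f = zero_mor U (Fo P Y) (Fo P X)"
    have "Fm R (Fm P f) = zero_mor T (Fo R (Fo P X)) (Fo R (Fo P Y))"
      unfolding 0 using hom_one[OF R.Fm_hom[OF PY PX] U.Hom_group[OF PY PX] T.Hom_group[OF RPX RPY]] .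
    then have if0: "i Y \<cdot>\<^bsub>T\<^esub> f = zero_mor T X (Fo R (Fo P Y))"
      using i_nat[OF X Y T.arr_mor[OF f]] T.zero_cmp[OF iX RPY] by simp
    show "phantom V T X Y f"
    proof (rule T.phantomI[OF f])
      fix D g assume D: "compact_object V T D" and g: "arr T g D X"
      show "f \<cdot>\<^bsub>T\<^esub> g = zero_mor T D Y"
      proof (rule T.pure_monoD(2)[OF i_mono[OF Y] D T.arr_cmp[OF g f]])
        show "i Y \<cdot>\<^bsub>T\<^esub> (f \<cdot>\<^bsub>T\<^esub> g) = zero_mor T D (Fo R (Fo P Y))"
          using T.assoc[OF g f iY] if0 T.zero_cmp[OF g RPY] by simp
      qed
    qed
  qed
qed

theorem theorem3p6:
  fixes V :: "'v itself"
    and T :: "('o, 'm, 'x) tricat_scheme"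
    and U :: "('p, 'n, 'y) tricat_scheme"
    and P :: "('o, 'm, 'p, 'n) contra_functor"
    and R :: "('p, 'n, 'o, 'm) contra_functor"
  assumes "inaccessible V"
    and "duality_triple V T U P R"
  shows "(\<forall>X\<in>obj T. \<forall>Y\<in>obj T. \<forall>f\<in>mor T X Y.
            phantom V T X Y f \<longleftrightarrow> Fm P f = zero_mor U (Fo P Y) (Fo P X)) \<and>
         (\<forall>A B C f g h. triangle T A B C f g h \<longrightarrow>
            (pure_triangle V T A B C f g h \<longleftrightarrow>
             split_triangle U (Fo P C) (Fo P B) (Fo P A) (Fm P g) (Fm P f)
               (induced_connecting U P A h)))"
proof (intro conjI ballI allI impI)
  have T: "compactly_generated V T" and U: "compactly_generated V U"
    using assms(2) by (simp_all add: duality_triple_def)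
  interpret T: triangulated_category T using T by (simp add: compactly_generated_def)
  interpret U: triangulated_category U using U by (simp add: compactly_generated_def)
  interpret P: exact_contra_functor T U P using assms(2) by (simp add: duality_triple_def)
  show "phantom V T X Y f \<longleftrightarrow> Fm P f = zero_mor U (Fo P Y) (Fo P X)"
    if "X \<in> obj T" "Y \<in> obj T" "f \<in> mor T X Y" for X Y f
    using phantom_iff_dual_zero[OF assms arrI[OF that]] .
  fix A B C f g h assume t: "triangle T A B C f g h"
  note h = T.triangle_arr(3)[OF t] and A = T.arr_dom[OF T.triangle_arr(1)[OF t]]
  have cop: "has_small_coproducts V T" using T by (simp add: compactly_generated_def)
  show "pure_triangle V T A B C f g h \<longleftrightarrow>
      split_triangle U (Fo P C) (Fo P B) (Fo P A) (Fm P g) (Fm P f) (induced_connecting U P A h)"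
    \<comment> \<open>Both sides are conditions on \<open>h\<close>: purity says that it is phantom,
      and splitting says that the induced connecting map, equivalently \<open>Fm P h\<close>, is
      zero.\<close>
    using T.pure_triangle_iff_phantom[OF cop t] phantom_iff_dual_zero[OF assms h]
      P.induced_connecting_eq_zero_iff[OF T.triangulated_category_axioms U.triangulated_category_axioms h A]
      U.split_triangle_iff[OF P.F_triangle[OF t]] by simp
qed

end
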